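(* There is an automaton group $G$ such that both the order problem and the Engel problem are undecidable in $G$.
   Context: A Mealy automaton is a tuple $(A,\Sigma,\delta,\sigma)$ where $A$ (the states) and $\Sigma$ (the alphabet) are finite sets, and $\delta\colon A\times\Sigma\to A$, $\sigma\colon A\times\Sigma\to\Sigma$ are maps. For $p\in A$ let $\sigma_p\colon\Sigma^*\to\Sigma^*$ be the length-preserving map defined recursively by $\sigma_p(\text{empty word})=\text{empty word}$ and $\sigma_p(xy)=\sigma(p,x)\,\sigma_{\delta(p,x)}(y)$ for $x\in\Sigma$, $y\in\Sigma^*$. If all $\sigma_p$ ($p\in A$) are bijective, the group generated by the automaton is the subgroup of $\mathrm{Aut}(\Sigma^* )$ generated by all $\sigma_p$, $p\in A$. An automaton group is a group generated by a Mealy automaton. For a group $G$ with finite generating set $S$ (closed under inverses): the order problem asks, given a word $w\in S^*$, whether $w$ represents an element of finite order in $G$; the Engel problem asks, given words $v,w\in S^*$, whether there exists $n\ge1$ such that the $n$-iterated commutator $[\dots[[v,w],w],\dots,w]$ represents the identity of $G$, where $[g,h]=g^{-1}h^{-1}gh$. The decidability of each problem does not depend on the choice of the finite generating set. *)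

theory Defs
  imports "HOL-Algebra.Generated_Groups" "HOL-Algebra.Bij" "HOL-Library.Nat_Bijection" "HOL-Library.Sublist"
begin

section \<open>Decidability\<close>

text \<open>
  Partial recursive functions. A term denotes a partial function on argument lists of every
  length; restricted to any fixed length it is a partial recursive function of that arity.
\<close>

datatype recf =
    Zero
  | Succ
  | Proj nat
  | Comp recf "recf list"
  | PrimRec recf recf
  | Mu recf

inductive evaluates :: "recf \<Rightarrow> nat list \<Rightarrow> nat \<Rightarrow> bool" where
  zero: "evaluates Zero xs 0"
| succ: "evaluates Succ [x] (Suc x)"
| proj: "i < length xs \<Longrightarrow> evaluates (Proj i) xs (xs ! i)"
| comp: "list_all2 (\<lambda>g y. evaluates g xs y) gs ys \<Longrightarrow> evaluates f ys z
    \<Longrightarrow> evaluates (Comp f gs) xs z"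
| primrec_0: "evaluates f xs y \<Longrightarrow> evaluates (PrimRec f g) (0 # xs) y"
| primrec_Suc: "evaluates (PrimRec f g) (n # xs) r \<Longrightarrow> evaluates g (n # r # xs) y
    \<Longrightarrow> evaluates (PrimRec f g) (Suc n # xs) y"
| mu: "evaluates f (n # xs) 0 \<Longrightarrow> (\<forall>m<n. \<exists>y>0. evaluates f (m # xs) y)
    \<Longrightarrow> evaluates (Mu f) xs n"

lemma evaluates_deterministic:
  "evaluates f xs y \<Longrightarrow> evaluates f xs z \<Longrightarrow> y = z"
proof (induction f xs y arbitrary: z rule: evaluates.induct)
  case (comp xs gs ys f w)
  from comp.prems obtain ys' where ys': "list_all2 (\<lambda>g y. evaluates g xs y) gs ys'" "evaluates f ys' z"
    by (cases rule: evaluates.cases) auto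
  have "ys = ys'"
    using comp.IH(1) ys'(1) by (auto simp: list_all2_conv_all_nth intro!: nth_equalityI)
  with comp.IH(2) ys'(2) show ?case by blast
next
  case (mu f n xs)
  from mu.prems have z: "evaluates f (z # xs) 0" "\<forall>m<z. \<exists>y>0. evaluates f (m # xs) y"
    by (cases rule: evaluates.cases; auto)+
  show ?case
  proof (rule linorder_cases[of n z])
    assume "n < z"
    with z mu.IH(1) show ?thesis by fastforce
  next
    assume "z < n"
    with z mu.IH(2) show ?thesis by fastforce
  qed
next
  case (primrec_Suc f g n xs r y)
  from primrec_Suc.prems obtain r' where
    "evaluates (PrimRec f g) (n # xs) r'" "evaluates g (n # r' # xs) z"
    by (cases rule: evaluates.cases) auto
  with primrec_Suc.IH show ?case by blast
qed (erule evaluates.cases; auto)+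

definition recursive_set :: "nat set \<Rightarrow> bool" where
  "recursive_set A \<longleftrightarrow> (\<exists>f. \<forall>n. evaluates f [n] (if n \<in> A then 1 else 0))"

text \<open>
  Words over a finite alphabet \<open>S\<close> are coded by natural numbers after numbering the letters.
  For finite \<open>S\<close> any two injective numberings lead to the same decidable languages.
\<close>

definition word_code :: "('s \<Rightarrow> nat) \<Rightarrow> 's list \<Rightarrow> nat" where
  "word_code e w = list_encode (map e w)"

definition decidable_language :: "'s set \<Rightarrow> 's list set \<Rightarrow> bool" where
  "decidable_language S L \<longleftrightarrow> (\<exists>e. inj_on e S \<and> recursive_set (word_code e ` L))"

definition decidable_word_relation :: "'s set \<Rightarrow> ('s list \<times> 's list) set \<Rightarrow> bool" where
  "decidable_word_relation S R \<longleftrightarrow>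
    (\<exists>e. inj_on e S \<and>
      recursive_set ((\<lambda>(v, w). prod_encode (word_code e v, word_code e w)) ` R))"


section \<open>Order problem and Engel problem\<close>

definition symmetric_generating_set :: "('g, 'b) monoid_scheme \<Rightarrow> 'g set \<Rightarrow> bool" where
  "symmetric_generating_set G S \<longleftrightarrow>
    finite S \<and> S \<subseteq> carrier G \<and> (\<forall>s\<in>S. inv\<^bsub>G\<^esub> s \<in> S) \<and> generate G S = carrier G"

text \<open>The letters of a word are the generators themselves.\<close>

definition word_value :: "('g, 'b) monoid_scheme \<Rightarrow> 'g list \<Rightarrow> 'g" where
  "word_value G w = foldr (\<lambda>x y. x \<otimes>\<^bsub>G\<^esub> y) w \<one>\<^bsub>G\<^esub>"

definition finite_order :: "('g, 'b) monoid_scheme \<Rightarrow> 'g \<Rightarrow> bool" where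
  "finite_order G g \<longleftrightarrow> (\<exists>n::nat. n \<ge> 1 \<and> g [^]\<^bsub>G\<^esub> n = \<one>\<^bsub>G\<^esub>)"

definition commutator :: "('g, 'b) monoid_scheme \<Rightarrow> 'g \<Rightarrow> 'g \<Rightarrow> 'g" where
  "commutator G g h = inv\<^bsub>G\<^esub> g \<otimes>\<^bsub>G\<^esub> inv\<^bsub>G\<^esub> h \<otimes>\<^bsub>G\<^esub> g \<otimes>\<^bsub>G\<^esub> h"

fun iterated_commutator :: "('g, 'b) monoid_scheme \<Rightarrow> nat \<Rightarrow> 'g \<Rightarrow> 'g \<Rightarrow> 'g" where
  "iterated_commutator G 0 g h = g"
| "iterated_commutator G (Suc n) g h = commutator G (iterated_commutator G n g h) h"

definition order_problem :: "('g, 'b) monoid_scheme \<Rightarrow> 'g set \<Rightarrow> 'g list set" where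
  "order_problem G S = {w \<in> lists S. finite_order G (word_value G w)}"

definition engel_problem ::
  "('g, 'b) monoid_scheme \<Rightarrow> 'g set \<Rightarrow> ('g list \<times> 'g list) set" where
  "engel_problem G S = {(v, w) \<in> lists S \<times> lists S.
    \<exists>n\<ge>1. iterated_commutator G n (word_value G v) (word_value G w) = \<one>\<^bsub>G\<^esub>}"


section \<open>Automaton groups\<close>

record ('q, 'a) mealy =
  states :: "'q set"
  alphabet :: "'a set"
  step :: "'q \<times> 'a \<Rightarrow> 'q"
  outp :: "'q \<times> 'a \<Rightarrow> 'a"

definition mealy_automaton :: "('q, 'a) mealy \<Rightarrow> bool" where
  "mealy_automaton M \<longleftrightarrow> finite (states M) \<and> finite (alphabet M) \<and>
    step M \<in> states M \<times> alphabet M \<rightarrow> states M \<and>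
    outp M \<in> states M \<times> alphabet M \<rightarrow> alphabet M"

fun run :: "('q, 'a) mealy \<Rightarrow> 'q \<Rightarrow> 'a list \<Rightarrow> 'a list" where
  "run M p [] = []"
| "run M p (x # y) = outp M (p, x) # run M (step M (p, x)) y"

definition state_map :: "('q, 'a) mealy \<Rightarrow> 'q \<Rightarrow> 'a list \<Rightarrow> 'a list" where
  "state_map M p = restrict (run M p) (lists (alphabet M))"

definition invertible_mealy :: "('q, 'a) mealy \<Rightarrow> bool" where
  "invertible_mealy M \<longleftrightarrow>
    (\<forall>p\<in>states M. bij_betw (state_map M p) (lists (alphabet M)) (lists (alphabet M)))"

text \<open>
  The automorphism group of the rooted tree of words over \<open>X\<close>: bijections that preserve length
  and prefixes. As in \<^const>\<open>BijGroup\<close>, the elements are extensional and the product is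
  \<open>(g f)(x) = g (f x)\<close>.
\<close>

definition tree_aut :: "'a set \<Rightarrow> ('a list \<Rightarrow> 'a list) set" where
  "tree_aut X = {f \<in> Bij (lists X).
    (\<forall>u\<in>lists X. length (f u) = length u) \<and>
    (\<forall>u\<in>lists X. \<forall>v\<in>lists X. prefix u v \<longrightarrow> prefix (f u) (f v))}"

definition tree_aut_group :: "'a set \<Rightarrow> ('a list \<Rightarrow> 'a list) monoid" where
  "tree_aut_group X = BijGroup (lists X) \<lparr>carrier := tree_aut X\<rparr>"

definition mealy_group :: "('q, 'a) mealy \<Rightarrow> ('a list \<Rightarrow> 'a list) monoid" where
  "mealy_group M = subgroup_generated (tree_aut_group (alphabet M)) (state_map M ` states M)"

text \<open>State sets are finite, so it is no restriction to take them to be sets of naturals.\<close>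

definition automaton_group :: "('a list \<Rightarrow> 'a list) monoid \<Rightarrow> bool" where
  "automaton_group G \<longleftrightarrow>
    (\<exists>M :: (nat, 'a) mealy. mealy_automaton M \<and> invertible_mealy M \<and> G = mealy_group M)"


subsection \<open>Well-definedness\<close>

lemma subgroup_tree_aut: "subgroup (tree_aut X) (BijGroup (lists X))"
proof (rule group.subgroupI[OF group_BijGroup])
  show "tree_aut X \<subseteq> carrier (BijGroup (lists X))"
    by (auto simp: tree_aut_def BijGroup_def)
  show "tree_aut X \<noteq> {}"
    using id_Bij[of "lists X"] by (auto simp: tree_aut_def intro!: exI[of _ "\<lambda>x\<in>lists X. x"])
next
  fix f assume f: "f \<in> tree_aut X"
  let ?g = "inv_into (lists X) f"
  from f have B: "f \<in> Bij (lists X)" and bij: "bij_betw f (lists X) (lists X)"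
    and len: "\<And>u. u \<in> lists X \<Longrightarrow> length (f u) = length u"
    and pre: "\<And>u v. u \<in> lists X \<Longrightarrow> v \<in> lists X \<Longrightarrow> prefix u v \<Longrightarrow> prefix (f u) (f v)"
    by (auto simp: tree_aut_def Bij_def)
  have g: "?g u \<in> lists X" "f (?g u) = u" if "u \<in> lists X" for u
    using bij that by (metis bij_betw_def inv_into_into, metis bij_betw_inv_into_right)
  have glen: "length (?g u) = length u" if "u \<in> lists X" for u
    using g[OF that] len by metis
  have "prefix (?g u) (?g v)" if "u \<in> lists X" "v \<in> lists X" "prefix u v" for u v
  proof -
    define t where "t = take (length u) (?g v)"
    have t: "t \<in> lists X" "prefix t (?g v)"
      using g(1)[OF that(2)] by (auto simp: t_def take_is_prefix dest: in_set_takeD)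
    have "length (f t) = length u"
      using len[OF t(1)] glen[OF that(2)] prefix_length_le[OF that(3)] by (simp add: t_def)
    moreover have "prefix (f t) v"
      using pre[OF t(1) g(1)[OF that(2)] t(2)] g(2)[OF that(2)] by simp
    ultimately have "f t = u"
      using that(3) by (metis prefix_length_prefix prefix_order.eq_iff order_refl)
    hence "t = ?g u"
      using bij t(1) by (metis bij_betw_inv_into_left)
    with t(2) show ?thesis by simp
  qed
  with B g glen show "inv\<^bsub>BijGroup (lists X)\<^esub> f \<in> tree_aut X"
    using restrict_inv_into_Bij[OF B] by (simp add: tree_aut_def inv_BijGroup)
next
  fix f g assume "f \<in> tree_aut X" "g \<in> tree_aut X"
  moreover from this have "f u \<in> lists X" "g u \<in> lists X" if "u \<in> lists X" for u
    using that by (auto simp: tree_aut_def dest!: Bij_imp_funcset)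
  ultimately show "f \<otimes>\<^bsub>BijGroup (lists X)\<^esub> g \<in> tree_aut X"
    by (simp add: tree_aut_def BijGroup_def compose_Bij) (simp add: compose_def)
qed

lemma group_tree_aut_group: "group (tree_aut_group X)"
  unfolding tree_aut_group_def
  by (rule subgroup.subgroup_is_group[OF subgroup_tree_aut group_BijGroup])

lemma group_mealy_group: "group (mealy_group M)"
  by (simp add: mealy_group_def group.group_subgroup_generated group_tree_aut_group)

lemma length_run [simp]: "length (run M p u) = length u"
  by (induction u arbitrary: p) auto

lemma prefix_run: "prefix u v \<Longrightarrow> prefix (run M p u) (run M p v)"
proof (induction u arbitrary: p v)
  case (Cons x u)
  then show ?case by (cases v) auto
qed simp

lemma state_map_in_tree_aut:
  assumes "invertible_mealy M" "p \<in> states M"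
  shows "state_map M p \<in> carrier (tree_aut_group (alphabet M))"
  using assms
  by (auto simp: tree_aut_group_def tree_aut_def Bij_def invertible_mealy_def prefix_run)
    (auto simp: state_map_def prefix_run)

lemma symmetric_generating_set_mealy_group:
  assumes "mealy_automaton M" "invertible_mealy M"
  defines "T \<equiv> state_map M ` states M"
  shows "symmetric_generating_set (mealy_group M) (T \<union> m_inv (mealy_group M) ` T)"
proof -
  interpret A: group "tree_aut_group (alphabet M)" by (rule group_tree_aut_group)
  interpret G: group "mealy_group M" by (rule group_mealy_group)
  have TA: "T \<subseteq> carrier (tree_aut_group (alphabet M))"
    using state_map_in_tree_aut[OF assms(2)] by (auto simp: T_def)
  have T: "T \<subseteq> carrier (mealy_group M)"
    using A.subgroup_generated_subset_carrier_subset[OF TA] by (simp add: mealy_group_def T_def)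
  have "subgroup_generated (mealy_group M) T = mealy_group M"
    using A.subgroup_generated2 by (simp add: mealy_group_def T_def)
  hence genT: "generate (mealy_group M) T = carrier (mealy_group M)"
    using T by (metis carrier_subgroup_generated Int_absorb1)
  let ?S = "T \<union> m_inv (mealy_group M) ` T"
  have S: "?S \<subseteq> carrier (mealy_group M)" using T by auto
  have "generate (mealy_group M) T \<subseteq> generate (mealy_group M) ?S"
    by (rule G.mono_generate) simp
  hence "generate (mealy_group M) ?S = carrier (mealy_group M)"
    using genT G.generate_incl[OF S] by auto
  moreover have "finite ?S" using assms(1) by (simp add: mealy_automaton_def T_def)
  moreover have "\<forall>s\<in>?S. inv\<^bsub>mealy_group M\<^esub> s \<in> ?S"
    using T by (auto simp: subset_iff)
  ultimately show ?thesis using S by (simp add: symmetric_generating_set_def)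
qed

end

theory Submission
  imports Defs "HOL-Library.Countable" "HOL-Library.Infinite_Set"
    "HOL-Computational_Algebra.Primes"
begin

text \<open>
  Fix a Minsky machine whose halting problem is undecidable. A configuration with program counter
  \<open>j\<close> and registers \<open>m\<^sub>0, \<dots>, m\<^sub>k\<close> is represented by the automorphism \<open>\<tau>\<inverse> b\<^sub>j \<tau> a\<close> with
  \<open>\<tau> = t\<^sub>0^(2^m\<^sub>0) \<dots> t\<^sub>k^(2^m\<^sub>k)\<close>, where \<open>a\<close> and all \<open>b\<^sub>j\<close> are involutions, so that it is a rotation of
  a dihedral group. The alphabet has four letters for every instruction. On the letters of the
  \<open>j\<close>-th instruction \<open>b\<^sub>j\<close> and \<open>a\<close> move a distinguished letter along an orbit of length \<open>d = 2\<close> or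
  \<open>d = 4\<close>, and the \<open>d\<close>-th power has the automorphism of the next configuration as its section there:
  passing twice through sections containing \<open>t\<^sub>i\<close> doubles the exponent of \<open>t\<^sub>i\<close>, and letting \<open>t\<^sub>i\<close> act
  as an odometer on two letters halves it and detects exponent \<open>1\<close>. Below every other letter the
  section of the \<open>d\<close>-th power is a conjugate of this one or has order at most two. When
  the machine halts, \<open>b\<^sub>j\<close> is trivial. So the order is a
  power of two if the machine halts, and infinite otherwise. Since \<open>a\<close> inverts \<open>g = \<tau>\<inverse> b\<^sub>j \<tau> a\<close>, the
  iterated commutator \<open>[\<dots>[g, a], \<dots>, a]\<close> is \<open>g^((-2)^n)\<close>, which turns the order problem into the
  Engel problem.
\<close>

section \<open>Closure properties of computable functions\<close>

text \<open>Only lists of length \<open>k\<close> are constrained, because a term of type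
  \<open>recf\<close> has its own behaviour at every other length. As \<open>F\<close> is total,
  these are the total recursive functions of arity \<open>k\<close>.\<close>

definition computable :: "nat \<Rightarrow> (nat list \<Rightarrow> nat) \<Rightarrow> bool" where
  "computable k F \<longleftrightarrow> (\<exists>f. \<forall>xs. length xs = k \<longrightarrow> evaluates f xs (F xs))"

lemma computable_cong:
  assumes "computable k F" "\<And>xs. length xs = k \<Longrightarrow> F xs = G xs"
  shows "computable k G"
  using assms unfolding computable_def by fastforce

lemma evaluates_Proj_eq: "i < length xs \<Longrightarrow> y = xs ! i \<Longrightarrow> evaluates (Proj i) xs y"
  by (simp add: evaluates.proj)

lemma computable_nth: "i < k \<Longrightarrow> computable k (\<lambda>xs. xs ! i)"
  unfolding computable_def by (auto intro!: exI[of _ "Proj i"] evaluates.proj)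

lemma computable_nth_tl: "i < k \<Longrightarrow> computable (Suc k) (\<lambda>ys. tl ys ! i)"
  by (rule computable_cong[OF computable_nth[of "Suc i"]]) (auto simp: nth_tl)

lemma computable_nth_drop: "i < k \<Longrightarrow> computable (Suc (Suc k)) (\<lambda>ys. drop 2 ys ! i)"
  by (rule computable_cong[OF computable_nth[of "i + 2"]]) auto

lemma computable_comp:
  assumes F: "computable (length Gs) F" and Gs: "\<And>G. G \<in> set Gs \<Longrightarrow> computable k G"
  shows "computable k (\<lambda>xs. F (map (\<lambda>G. G xs) Gs))"
proof -
  obtain f where f: "evaluates f ys (F ys)" if "length ys = length Gs" for ys
    using F unfolding computable_def by blast
  have "\<forall>G\<in>set Gs. \<exists>g. \<forall>xs. length xs = k \<longrightarrow> evaluates g xs (G xs)"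
    using Gs unfolding computable_def by blast
  then obtain c where c: "evaluates (c G) xs (G xs)" if "G \<in> set Gs" "length xs = k" for G xs
    by metis
  have "evaluates (Comp f (map c Gs)) xs (F (map (\<lambda>G. G xs) Gs))" if "length xs = k" for xs
    by (rule evaluates.comp[where ys = "map (\<lambda>G. G xs) Gs"])
      (auto simp: list_all2_conv_all_nth c that f)
  then show ?thesis unfolding computable_def by blast
qed

lemma computable_comp1:
  assumes "computable 1 (\<lambda>xs. F (xs ! 0))" "computable k G"
  shows "computable k (\<lambda>xs. F (G xs))"
  using computable_comp[of "[G]" "\<lambda>xs. F (xs ! 0)" k] assms by simp

lemma computable_comp2:
  assumes "computable 2 (\<lambda>xs. F (xs ! 0) (xs ! 1))" "computable k G" "computable k H"
  shows "computable k (\<lambda>xs. F (G xs) (H xs))"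
proof -
  have "computable (length [G, H]) (\<lambda>xs. F (xs ! 0) (xs ! 1))"
    using assms(1) by (simp add: numeral_2_eq_2)
  then show ?thesis
    using computable_comp[of "[G, H]" "\<lambda>xs. F (xs ! 0) (xs ! 1)" k] assms by auto
qed

lemma computable_Suc: "computable k F \<Longrightarrow> computable k (\<lambda>xs. Suc (F xs))"
proof (rule computable_comp1[where F = Suc])
  have "evaluates Succ xs (Suc (xs ! 0))" if "length xs = 1" for xs
    using that by (cases xs) (auto intro: evaluates.succ)
  then show "computable 1 (\<lambda>xs. Suc (xs ! 0))"
    unfolding computable_def by blast
qed

lemma computable_const: "computable k (\<lambda>_. c)"
proof (induction c)
  case 0
  show ?case unfolding computable_def by (blast intro: evaluates.zero)
qed (rule computable_Suc)

lemma computable_rec_nat: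
  assumes N: "computable k N" and F: "computable k F"
    and G: "computable (Suc (Suc k)) (\<lambda>ys. G (ys ! 0) (ys ! 1) (drop 2 ys))"
  shows "computable k (\<lambda>xs. rec_nat (F xs) (\<lambda>n r. G n r xs) (N xs))"
proof -
  obtain n where n: "evaluates n xs (N xs)" if "length xs = k" for xs
    using N unfolding computable_def by blast
  obtain f where f: "evaluates f xs (F xs)" if "length xs = k" for xs
    using F unfolding computable_def by blast
  obtain g where g: "evaluates g ys (G (ys ! 0) (ys ! 1) (drop 2 ys))"
    if "length ys = Suc (Suc k)" for ys
    using G unfolding computable_def by blast
  have rec: "evaluates (PrimRec f g) (m # xs) (rec_nat (F xs) (\<lambda>n r. G n r xs) m)"
    if "length xs = k" for m xs
  proof (induction m)
    case (Suc m)
    show ?case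
      using evaluates.primrec_Suc[OF Suc] g[of "m # _ # xs"] that by simp
  qed (simp add: evaluates.primrec_0 f that)
  \<comment> \<open>\<open>PrimRec\<close> expects its counter at the head of the list, so the
    projections rebuild \<open>xs\<close> behind \<open>N xs\<close>.\<close>
  have "evaluates (Comp (PrimRec f g) (n # map Proj [0..<k])) xs
      (rec_nat (F xs) (\<lambda>n r. G n r xs) (N xs))" if "length xs = k" for xs
    by (rule evaluates.comp[where ys = "N xs # xs"])
      (auto simp: that n rec list_all2_conv_all_nth nth_Cons' intro!: evaluates_Proj_eq)
  then show ?thesis unfolding computable_def by blast
qed

lemma computable_Least:
  assumes G: "computable (Suc k) (\<lambda>ys. G (ys ! 0) (tl ys))"
    and ex: "\<And>xs. length xs = k \<Longrightarrow> \<exists>n. G n xs = 0"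
  shows "computable k (\<lambda>xs. LEAST n. G n xs = 0)"
proof -
  obtain g where g: "evaluates g ys (G (ys ! 0) (tl ys))" if "length ys = Suc k" for ys
    using G unfolding computable_def by blast
  have "evaluates (Mu g) xs (LEAST n. G n xs = 0)" if xs: "length xs = k" for xs
  proof (rule evaluates.mu)
    let ?n = "LEAST n. G n xs = 0"
    have g': "evaluates g (m # xs) (G m xs)" for m using g[of "m # xs"] xs by simp
    show "evaluates g (?n # xs) 0" using g'[of ?n] LeastI_ex[OF ex[OF xs]] by simp
    show "\<forall>m<?n. \<exists>y>0. evaluates g (m # xs) y"
      using g' not_less_Least by blast
  qed
  then show ?thesis unfolding computable_def by blast
qed

lemmas computable_intros = computable_nth computable_const computable_Suc

lemma computable_add:
  assumes "computable k F" "computable k G"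
  shows "computable k (\<lambda>xs. F xs + G xs)"
proof -
  have "computable k (\<lambda>xs. rec_nat (F xs) (\<lambda>_ r. Suc r) (G xs))"
    by (intro computable_rec_nat computable_intros assms) simp
  moreover have "rec_nat a (\<lambda>_ r. Suc r) b = a + b" for a b :: nat by (induction b) auto
  ultimately show ?thesis by simp
qed

lemma computable_mult:
  assumes "computable k F" "computable k G"
  shows "computable k (\<lambda>xs. F xs * G xs)"
proof (rule computable_comp2[OF _ assms])
  have "computable 2 (\<lambda>xs. rec_nat 0 (\<lambda>_ r. r + xs ! 0) (xs ! 1))"
    by (intro computable_rec_nat computable_intros computable_add computable_nth_drop) auto
  moreover have "rec_nat 0 (\<lambda>_ r. r + a) b = a * b" for a b :: nat by (induction b) auto
  ultimately show "computable 2 (\<lambda>xs. xs ! 0 * xs ! 1)" by simp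
qed

lemma computable_power: "computable k F \<Longrightarrow> computable k (\<lambda>xs. c ^ F xs)"
proof (rule computable_comp1[where F = "\<lambda>n. c ^ n"])
  have "computable 1 (\<lambda>xs. rec_nat 1 (\<lambda>_ r. c * r) (xs ! 0))"
    by (intro computable_rec_nat computable_intros computable_mult) auto
  moreover have "rec_nat 1 (\<lambda>_ r. c * r) a = c ^ a" for a :: nat by (induction a) auto
  ultimately show "computable 1 (\<lambda>xs. c ^ (xs ! 0))" by simp
qed

lemma computable_diff:
  assumes "computable k F" "computable k G"
  shows "computable k (\<lambda>xs. F xs - G xs)"
proof (rule computable_comp2[OF _ assms])
  have "computable 1 (\<lambda>xs. rec_nat 0 (\<lambda>n _. n) (xs ! 0))"
    by (intro computable_rec_nat computable_intros) auto
  moreover have "rec_nat 0 (\<lambda>n _. n) a = a - 1" for a :: nat by (cases a) auto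
  ultimately have pred: "computable 1 (\<lambda>xs. xs ! 0 - 1)" by simp
  have "computable 2 (\<lambda>xs. rec_nat (xs ! 0) (\<lambda>_ r. r - 1) (xs ! 1))"
    by (intro computable_rec_nat computable_intros computable_comp1[OF pred]) auto
  moreover have "rec_nat a (\<lambda>_ r. r - 1) b = a - b" for a b :: nat by (induction b) auto
  ultimately show "computable 2 (\<lambda>xs. xs ! 0 - xs ! 1)" by simp
qed

lemma computable_if:
  assumes "computable k C" "computable k F" "computable k G"
  shows "computable k (\<lambda>xs. if C xs = 0 then F xs else G xs)"
proof -
  \<comment> \<open>With truncated subtraction, \<open>1 - C xs\<close> is the indicator of
    \<open>C xs = 0\<close>, and \<open>1 - (1 - C xs)\<close> that of its negation.\<close>
  have "computable k (\<lambda>xs. (1 - C xs) * F xs + (1 - (1 - C xs)) * G xs)"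
    by (intro computable_add computable_mult computable_diff computable_const assms)
  then show ?thesis by (rule computable_cong) (auto simp: not_less_eq_eq)
qed

lemma computable_triangle: "computable k F \<Longrightarrow> computable k (\<lambda>xs. triangle (F xs))"
proof (rule computable_comp1[where F = triangle])
  have "computable 1 (\<lambda>xs. rec_nat 0 (\<lambda>n r. r + Suc n) (xs ! 0))"
    by (intro computable_rec_nat computable_intros computable_add) auto
  moreover have "rec_nat 0 (\<lambda>n r. r + Suc n) a = triangle a" for a :: nat by (induction a) auto
  ultimately show "computable 1 (\<lambda>xs. triangle (xs ! 0))" by simp
qed

lemma computable_prod_encode:
  assumes "computable k F" "computable k G"
  shows "computable k (\<lambda>xs. prod_encode (F xs, G xs))"
  unfolding prod_encode_def
  by (simp, intro computable_add computable_triangle assms)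

lemma computable_prod_decode:
  assumes "computable k F"
  shows "computable k (\<lambda>xs. fst (prod_decode (F xs)))"
    and "computable k (\<lambda>xs. snd (prod_decode (F xs)))"
proof -
  \<comment> \<open>The code of a pair is \<open>triangle (m + n) + m\<close>. The search finds the
    diagonal \<open>m + n\<close> as the last triangular number not exceeding the code; both
    components follow by subtraction.\<close>
  define d where "d n = (LEAST s. Suc n - triangle (Suc s) = 0)" for n
  have ex: "\<exists>s. Suc n - triangle (Suc s) = 0" for n
    by (rule exI[of _ n]) simp
  have "computable 1 (\<lambda>xs. LEAST s. Suc (xs ! 0) - triangle (Suc s) = 0)"
  proof (rule computable_Least[where G = "\<lambda>s xs. Suc (xs ! 0) - triangle (Suc s)"])
    show "computable (Suc 1) (\<lambda>ys. Suc (tl ys ! 0) - triangle (Suc (ys ! 0)))"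
      by (intro computable_diff computable_triangle computable_intros computable_nth_tl) auto
  qed (rule ex)
  then have d: "computable 1 (\<lambda>xs. d (xs ! 0))" by (simp add: d_def)
  have d_eq: "d (prod_encode (m, n)) = m + n" for m n
    unfolding d_def
  proof (rule Least_equality)
    show "Suc (prod_encode (m, n)) - triangle (Suc (m + n)) = 0"
      by (simp add: prod_encode_def)
    fix s assume "Suc (prod_encode (m, n)) - triangle (Suc s) = 0"
    then have *: "triangle (m + n) < triangle (Suc s)"
      by (auto simp: prod_encode_def)
    have "mono triangle" by (intro mono_iff_le_Suc[THEN iffD2]) simp
    then have "\<not> Suc s \<le> m + n" using * by (meson monoD not_le)
    then show "m + n \<le> s" by simp
  qed
  have "fst (prod_decode n) = n - triangle (d n)" "snd (prod_decode n) = d n - (n - triangle (d n))"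
    for n
  proof -
    obtain a b where ab: "prod_decode n = (a, b)" by fastforce
    then have n: "n = prod_encode (a, b)" by (metis prod_decode_inverse)
    then have a: "n - triangle (a + b) = a" by (simp add: prod_encode_def)
    show "fst (prod_decode n) = n - triangle (d n)" "snd (prod_decode n) = d n - (n - triangle (d n))"
      using a ab d_eq[of a b] n[symmetric] by simp_all
  qed
  moreover have "computable k (\<lambda>xs. F xs - triangle (d (F xs)))"
    "computable k (\<lambda>xs. d (F xs) - (F xs - triangle (d (F xs))))"
    by (intro computable_diff computable_triangle computable_comp1[OF d] assms)+
  ultimately show "computable k (\<lambda>xs. fst (prod_decode (F xs)))"
    "computable k (\<lambda>xs. snd (prod_decode (F xs)))" by simp_all
qed

lemma recursive_set_iff_computable:
  "recursive_set D \<longleftrightarrow> computable 1 (\<lambda>xs. if xs ! 0 \<in> D then 1 else 0)"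
proof -
  have "(\<forall>xs. length xs = 1 \<longrightarrow> Q xs) \<longleftrightarrow> (\<forall>n. Q [n])" for Q :: "nat list \<Rightarrow> bool"
    by (metis One_nat_def length_0_conv length_Cons length_Suc_conv)
  then show ?thesis by (simp add: recursive_set_def computable_def)
qed

text \<open>Many-one reduction: this carries undecidability from the halting problem to the two word
  problems.\<close>

lemma recursive_set_vimage:
  assumes "recursive_set D" "computable 1 (\<lambda>xs. F (xs ! 0))"
  shows "recursive_set {n. F n \<in> D}"
  using computable_comp1[of "\<lambda>n. if n \<in> D then 1 else 0" 1 "\<lambda>xs. F (xs ! 0)"] assms
  by (simp add: recursive_set_iff_computable)

section \<open>Minsky machines and a universal halting set\<close>

datatype instr = Inc nat nat | Dec nat nat nat

fun exec :: "instr \<Rightarrow> (nat \<Rightarrow> nat) \<Rightarrow> nat \<times> (nat \<Rightarrow> nat)" where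
  "exec (Inc i j) m = (j, m(i := Suc (m i)))"
| "exec (Dec i j j') m = (if m i = 0 then (j', m) else (j, m(i := m i - 1)))"

text \<open>Configurations outside the program are fixed points, so a machine that has halted stays
  halted.\<close>

definition minsky_step :: "instr list \<Rightarrow> nat \<times> (nat \<Rightarrow> nat) \<Rightarrow> nat \<times> (nat \<Rightarrow> nat)" where
  "minsky_step P c = (if fst c < length P then exec (P ! fst c) (snd c) else c)"

definition halts :: "instr list \<Rightarrow> nat \<times> (nat \<Rightarrow> nat) \<Rightarrow> bool" where
  "halts P c \<longleftrightarrow> (\<exists>n. length P \<le> fst ((minsky_step P ^^ n) c))"

definition input :: "nat \<Rightarrow> nat \<times> (nat \<Rightarrow> nat)" where
  "input n = (0, (\<lambda>_. 0)(0 := n))"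

text \<open>One bound serves for registers and for labels. It delimits the primes in a Goedel
  number, and later the states \<open>T l\<close> and \<open>B l\<close> of the automaton.\<close>

fun bounded_instr :: "nat \<Rightarrow> instr \<Rightarrow> bool" where
  "bounded_instr N (Inc i j) \<longleftrightarrow> i < N \<and> j < N"
| "bounded_instr N (Dec i j j') \<longleftrightarrow> i < N \<and> j < N \<and> j' < N"

lemma bounded_instr_mono: "bounded_instr N a \<Longrightarrow> N \<le> N' \<Longrightarrow> bounded_instr N' a"
  by (cases a) auto

lemma ex_bounded_instr: "\<exists>N\<ge>length P. \<forall>a\<in>set P. bounded_instr N a"
proof (induction P)
  case (Cons a P)
  then obtain N where N: "N \<ge> length P" "\<forall>a\<in>set P. bounded_instr N a" by blast
  obtain M where M: "bounded_instr M a"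
  proof (cases a)
    case (Inc i j)
    then show ?thesis using that[of "Suc (i + j)"] by simp
  next
    case (Dec i j j')
    then show ?thesis using that[of "Suc (i + j + j')"] by simp
  qed
  show ?case
    by (rule exI[of _ "Suc (N + M)"]) (use N M in \<open>auto intro: bounded_instr_mono\<close>)
qed simp

section \<open>One-register machines on Goedel numbers and the diagonal halting set\<close>

definition code_hd :: "nat \<Rightarrow> nat" where
  "code_hd n = fst (prod_decode (n - 1))"

definition code_drop :: "nat \<Rightarrow> nat \<Rightarrow> nat" where
  "code_drop n k = rec_nat n (\<lambda>_ r. snd (prod_decode (r - 1))) k"

lemma code_drop: "code_drop (list_encode xs) k = list_encode (drop k xs)"
proof (induction k)
  case (Suc k)
  show ?case
  proof (cases "k < length xs")
    case True
    then show ?thesis using Suc by (simp add: code_drop_def Cons_nth_drop_Suc[symmetric])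
  next
    case False
    \<comment> \<open>Dropping past the end has to stay at \<open>0\<close>, the code of the empty
      list; this rests on \<open>0 - 1 = 0\<close> and on \<open>0\<close> coding the pair
      \<open>(0, 0)\<close>.\<close>
    have "prod_encode (0, 0) = 0" by (simp add: prod_encode_def)
    then have "prod_decode 0 = (0, 0)" by (metis prod_encode_inverse)
    then show ?thesis using Suc False by (simp add: code_drop_def)
  qed
qed (simp add: code_drop_def)

lemma code_drop_0: "code_drop 0 k = 0"
  using code_drop[of "[]" k] by simp

lemma code_hd_drop: "k < length xs \<Longrightarrow> code_hd (list_encode (drop k xs)) = xs ! k"
  by (simp add: code_hd_def Cons_nth_drop_Suc[symmetric])

text \<open>The factor \<open>r - q\<close> stops the search at \<open>q = r\<close> at the latest,
  so the function is total even for \<open>y = 0\<close>. For \<open>y > 0\<close> the value is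
  \<open>r / y\<close> rounded up, and multiplying back tests divisibility.\<close>

definition exact_quot :: "nat \<Rightarrow> nat \<Rightarrow> nat" where
  "exact_quot r y = (LEAST q. (r - q * y) * (r - q) = 0)"

lemma exact_quot_mult: "y > 0 \<Longrightarrow> exact_quot (q * y) y = q"
proof -
  assume "y > 0"
  moreover from this have "q * y \<le> s \<Longrightarrow> q \<le> s" for s
    by (metis le_trans mult.right_neutral mult_le_mono2 Suc_leI One_nat_def)
  ultimately show ?thesis
    unfolding exact_quot_def by (intro Least_equality) (auto dest: mult_right_le_imp_le)
qed

text \<open>One step of a machine with a single register \<open>r\<close>: an instruction \<open>(x, y, j, j')\<close> replaces
  \<open>r\<close> by \<open>x * r / y\<close> and jumps to \<open>j\<close> if \<open>y\<close> divides \<open>r\<close>, and jumps to \<open>j'\<close> otherwise.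
  The number \<open>e\<close> codes the program and \<open>s\<close> the pair of program counter and register.\<close>

definition gstep :: "nat \<Rightarrow> nat \<Rightarrow> nat" where
  "gstep e s =
    (let a = prod_decode (code_hd (code_drop e (fst (prod_decode s)))); r = snd (prod_decode s);
         b = prod_decode (snd a); c = prod_decode (snd b); q = exact_quot r (fst b)
     in if (q * fst b - r) + (r - q * fst b) = 0 then prod_encode (fst c, q * fst a)
        else prod_encode (snd c, r))"

text \<open>The start value is the diagonal: \<open>2 ^ e\<close> is the Goedel number of a memory
  with \<open>e\<close> in register \<open>0\<close>, so the program coded by \<open>e\<close> runs
  on its own code.\<close>

definition gstate :: "nat \<Rightarrow> nat \<Rightarrow> nat" where
  "gstate e n = rec_nat (prod_encode (0, 2 ^ e)) (\<lambda>_ s. gstep e s) n"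

text \<open>The value codes the program from the current instruction onwards; for a program code it
  is \<open>0\<close> exactly when the counter has left the program.\<close>

definition grest :: "nat \<Rightarrow> nat \<Rightarrow> nat" where
  "grest e n = code_drop e (fst (prod_decode (gstate e n)))"

definition universal_halting_set :: "nat set" where
  "universal_halting_set = {e. \<exists>n. grest e n = 0}"

lemma computable_exact_quot:
  assumes "computable k F" "computable k G"
  shows "computable k (\<lambda>xs. exact_quot (F xs) (G xs))"
proof (rule computable_comp2[where F = exact_quot, OF _ assms])
  show "computable 2 (\<lambda>xs. exact_quot (xs ! 0) (xs ! 1))"
    unfolding exact_quot_def
    by (rule computable_Least[where G = "\<lambda>q xs. (xs ! 0 - q * xs ! 1) * (xs ! 0 - q)"],
        intro computable_mult computable_diff computable_nth_tl computable_nth)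
      (auto intro: exI[of _ "_ ! 0"])
qed

lemma computable_code_drop:
  assumes "computable k F" "computable k G"
  shows "computable k (\<lambda>xs. code_drop (F xs) (G xs))"
  unfolding code_drop_def
  by (intro computable_rec_nat assms computable_prod_decode computable_diff computable_intros) auto

lemma computable_gstep:
  assumes "computable k F" "computable k G"
  shows "computable k (\<lambda>xs. gstep (F xs) (G xs))"
  unfolding gstep_def Let_def code_hd_def
  by (intro computable_if computable_add computable_diff computable_mult computable_prod_encode
    computable_prod_decode computable_exact_quot computable_code_drop computable_const assms)

lemma computable_grest: "computable 2 (\<lambda>xs. grest (xs ! 1) (xs ! 0))"
  unfolding grest_def gstate_def
  by (intro computable_code_drop computable_prod_decode computable_rec_nat computable_prod_encode
    computable_power computable_gstep computable_intros
    computable_nth_drop) auto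

definition nprime :: "nat \<Rightarrow> nat" where
  "nprime i = enumerate {p. prime p} i"

lemma prime_nprime: "prime (nprime i)"
  using enumerate_in_set[OF primes_infinite, of i] by (simp add: nprime_def)

lemma nprime_inject: "nprime i = nprime j \<longleftrightarrow> i = j"
  using strict_mono_enumerate[OF primes_infinite] by (simp add: nprime_def strict_mono_eq)

lemma nprime_0: "nprime 0 = 2"
  unfolding nprime_def enumerate_0
  by (rule Least_equality) (auto simp: prime_ge_2_nat)

definition goedel :: "nat \<Rightarrow> (nat \<Rightarrow> nat) \<Rightarrow> nat" where
  "goedel N m = (\<Prod>i<N. nprime i ^ m i)"

lemma nprime_dvd_goedel: "i < N \<Longrightarrow> nprime i dvd goedel N m \<longleftrightarrow> m i > 0"
proof
  assume "nprime i dvd goedel N m"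
  then obtain j where "nprime i dvd nprime j ^ m j"
    by (auto simp: goedel_def prime_dvd_prod_iff prime_nprime)
  then show "m i > 0"
    by (metis nprime_inject prime_nprime prime_dvd_power primes_dvd_imp_eq dvd_1_iff_1 gr0I
      power_0 not_prime_1)
next
  assume i: "i < N" and "m i > 0"
  then show "nprime i dvd goedel N m"
    unfolding goedel_def
    using dvd_power[of "m i" "nprime i"] dvd_prodI[of "{..<N}" i "\<lambda>i. nprime i ^ m i"]
    by (blast intro: dvd_trans)
qed

lemma goedel_upd: "i < N \<Longrightarrow> goedel N (m(i := Suc k)) = goedel N (m(i := k)) * nprime i"
proof -
  assume i: "i < N"
  have "goedel N (m(i := k)) = nprime i ^ k * (\<Prod>j\<in>{..<N} - {i}. nprime j ^ m j)" for k
    unfolding goedel_def using i by (simp add: prod.remove[of _ i])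
  then show ?thesis by simp
qed

text \<open>Register \<open>i\<close> is the exponent of the prime \<open>nprime i\<close>. Division
  by \<open>1\<close> always succeeds, so an increment always takes the first jump; a decrement
  tests for zero by divisibility.\<close>

fun instr_code :: "instr \<Rightarrow> nat" where
  "instr_code (Inc i j) = prod_encode (nprime i, prod_encode (1, prod_encode (j, j)))"
| "instr_code (Dec i j j') = prod_encode (1, prod_encode (nprime i, prod_encode (j, j')))"

lemma gstep_exec:
  assumes "j < length P" "bounded_instr N (P ! j)"
  shows "gstep (list_encode (map instr_code P)) (prod_encode (j, goedel N m)) =
    prod_encode (case exec (P ! j) m of (j', m') \<Rightarrow> (j', goedel N m'))"
proof -
  have hd: "code_hd (list_encode (drop j (map instr_code P))) = instr_code (P ! j)"
    using assms by (simp add: code_hd_drop del: drop_map)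
  show ?thesis
  proof (cases "P ! j")
    case (Inc i k)
    then show ?thesis
      using assms hd goedel_upd[of i N m "m i"] exact_quot_mult[of 1 "goedel N m"]
      by (simp add: gstep_def code_drop)
  next
    case (Dec i k k')
    then have i: "i < N" using assms by simp
    show ?thesis
    proof (cases "m i = 0")
      case True
      then have "\<not> nprime i dvd goedel N m" using nprime_dvd_goedel[OF i, of m] by simp
      then have "exact_quot (goedel N m) (nprime i) * nprime i \<noteq> goedel N m"
        by (metis dvd_triv_right)
      then show ?thesis
        using True Dec hd by (simp add: gstep_def code_drop Let_def)
    next
      case False
      then have *: "goedel N m = goedel N (m(i := m i - 1)) * nprime i"
        using goedel_upd[OF i, of m "m i - 1"] by simp
      then have "exact_quot (goedel N m) (nprime i) = goedel N (m(i := m i - 1))"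
        using exact_quot_mult prime_gt_0_nat[OF prime_nprime] by metis
      then show ?thesis
        using False Dec hd * by (simp add: gstep_def code_drop)
    qed
  qed
qed

text \<open>The witness is the code of \<open>P\<close>. This defeats every machine that would halt
  exactly on the complement of \<open>universal_halting_set\<close>.\<close>

lemma ex_code_halts: "\<exists>e. e \<in> universal_halting_set \<longleftrightarrow> halts P (input e)"
proof -
  obtain N where N: "\<forall>a\<in>set P. bounded_instr N a" "N \<ge> length P"
    using ex_bounded_instr by blast
  define e where "e = list_encode (map instr_code P)"
  show ?thesis
  proof (cases "P = []")
    case True
    then have "grest e 0 = 0"
      by (simp add: grest_def e_def code_drop_0)
    then show ?thesis using True by (auto simp: universal_halting_set_def halts_def)
  next
    case False
    \<comment> \<open>Positivity puts register \<open>0\<close> among the first \<open>N\<close>, so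
      that the input really has Goedel number \<open>2 ^ e\<close>.\<close>
    then have "N > 0" using N(2) by (cases P) auto
    have "goedel N (snd (input e)) = (\<Prod>i<N. if i = 0 then 2 ^ e else 1)"
      unfolding goedel_def input_def by (rule prod.cong) (auto simp: nprime_0)
    also have "\<dots> = 2 ^ e" using \<open>N > 0\<close> by (simp add: prod.delta)
    finally have "goedel N (snd (input e)) = 2 ^ e" .
    then have start: "gstate e 0 = prod_encode (fst (input e), goedel N (snd (input e)))"
      by (simp add: gstate_def input_def)
    let ?c = "\<lambda>n. (minsky_step P ^^ n) (input e)"
    \<comment> \<open>The simulation is claimed only until the first halting time: afterwards
      \<open>minsky_step\<close> stands still, while \<open>gstep\<close> goes on with whatever
      \<open>0\<close> decodes to.\<close>
    have sim: "gstate e n = prod_encode (fst (?c n), goedel N (snd (?c n)))"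
      if "\<And>k. k < n \<Longrightarrow> fst (?c k) < length P" for n
      using that
    proof (induction n)
      case (Suc n)
      have "fst (?c n) < length P" using Suc.prems by simp
      then have "gstep e (prod_encode (fst (?c n), goedel N (snd (?c n)))) =
          prod_encode (fst (?c (Suc n)), goedel N (snd (?c (Suc n))))"
        unfolding e_def using N
        by (subst gstep_exec) (auto simp: minsky_step_def e_def split: prod.splits)
      then show ?case using Suc by (simp add: gstate_def)
    qed (use start in simp)
    have rest: "grest e n = list_encode (drop (fst (?c n)) (map instr_code P))"
      if "\<And>k. k < n \<Longrightarrow> fst (?c k) < length P" for n
      using sim[OF that] by (simp add: grest_def e_def code_drop)
    have zero: "list_encode xs = 0 \<longleftrightarrow> xs = []" for xs by (cases xs) auto
    have "(\<exists>n. grest e n = 0) \<longleftrightarrow> halts P (input e)"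
    proof
      assume "halts P (input e)"
      then obtain n where n: "length P \<le> fst (?c n)"
        and least: "\<And>k. k < n \<Longrightarrow> \<not> length P \<le> fst (?c k)"
        unfolding halts_def using exists_least_iff[of "\<lambda>n. length P \<le> fst (?c n)"] by blast
      then have "grest e n = 0" by (subst rest) (auto simp: not_le zero)
      then show "\<exists>n. grest e n = 0" ..
    next
      assume "\<exists>n. grest e n = 0"
      then obtain n where n: "grest e n = 0" ..
      show "halts P (input e)"
      proof (rule ccontr)
        assume "\<not> halts P (input e)"
        then have c: "fst (?c k) < length P" for k by (auto simp: halts_def not_le)
        then have "length P \<le> fst (?c n)" using rest[of n] n by (simp add: zero)
        with c[of n] show False by simp
      qed
    qed
    then show ?thesis unfolding universal_halting_set_def by blast
  qed
qed

section \<open>Compiling recursive functions to Minsky machines\<close>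

datatype com = INC nat | CLR nat | Seq com com | Loop nat com

inductive big :: "com \<Rightarrow> (nat \<Rightarrow> nat) \<Rightarrow> (nat \<Rightarrow> nat) \<Rightarrow> bool" where
  INC: "big (INC r) \<sigma> (\<sigma>(r := Suc (\<sigma> r)))"
| CLR: "big (CLR r) \<sigma> (\<sigma>(r := 0))"
| Seq: "big c \<sigma> \<tau> \<Longrightarrow> big d \<tau> \<rho> \<Longrightarrow> big (Seq c d) \<sigma> \<rho>"
| Loop_0: "\<sigma> r = 0 \<Longrightarrow> big (Loop r c) \<sigma> \<sigma>"
| Loop_Suc: "\<sigma> r = Suc n \<Longrightarrow> big c (\<sigma>(r := n)) \<tau> \<Longrightarrow> big (Loop r c) \<tau> \<rho> \<Longrightarrow> big (Loop r c) \<sigma> \<rho>"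

text \<open>A register can be read only by a loop that consumes it, so \<open>a\<close> is emptied
  into \<open>b\<close> and \<open>t\<close> and then restored from \<open>t\<close>.\<close>

definition copy :: "nat \<Rightarrow> nat \<Rightarrow> nat \<Rightarrow> com" where
  "copy a b t = Seq (CLR b) (Seq (CLR t) (Seq (Loop a (Seq (INC b) (INC t))) (Loop t (INC a))))"

lemma big_Loop_move: "a \<noteq> b \<Longrightarrow> big (Loop a (INC b)) \<sigma> (\<sigma>(a := 0, b := \<sigma> b + \<sigma> a))"
proof (induction "\<sigma> a" arbitrary: \<sigma>)
  case 0
  from 0(1) have a: "\<sigma> a = 0" by (rule sym)
  then have "\<sigma>(a := 0, b := \<sigma> b + \<sigma> a) = \<sigma>" by (intro ext) auto
  then show ?case using Loop_0[of \<sigma> a, OF a] by metis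
next
  case (Suc n)
  let ?\<tau> = "(\<sigma>(a := n))(b := Suc ((\<sigma>(a := n)) b))"
  have "big (Loop a (INC b)) ?\<tau> (?\<tau>(a := 0, b := ?\<tau> b + ?\<tau> a))"
    using Suc.prems by (intro Suc.hyps(1)) auto
  moreover have "?\<tau>(a := 0, b := ?\<tau> b + ?\<tau> a) = \<sigma>(a := 0, b := \<sigma> b + \<sigma> a)"
    using Suc.hyps(2)[symmetric] Suc.prems by (intro ext) auto
  ultimately show ?case using Loop_Suc[where \<tau> = ?\<tau>, OF Suc.hyps(2)[symmetric] INC] by metis
qed

lemma big_Loop_move2:
  "a \<noteq> b \<Longrightarrow> a \<noteq> t \<Longrightarrow> b \<noteq> t \<Longrightarrow>
    big (Loop a (Seq (INC b) (INC t))) \<sigma> (\<sigma>(a := 0, b := \<sigma> b + \<sigma> a, t := \<sigma> t + \<sigma> a))"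
proof (induction "\<sigma> a" arbitrary: \<sigma>)
  case 0
  from 0(1) have a: "\<sigma> a = 0" by (rule sym)
  then have "\<sigma>(a := 0, b := \<sigma> b + \<sigma> a, t := \<sigma> t + \<sigma> a) = \<sigma>"
    by (intro ext) auto
  then show ?case using Loop_0[of \<sigma> a, OF a] by metis
next
  case (Suc n)
  let ?\<tau> = "\<sigma>(a := n, b := Suc (\<sigma> b), t := Suc (\<sigma> t))"
  have "big (Loop a (Seq (INC b) (INC t))) ?\<tau> (?\<tau>(a := 0, b := ?\<tau> b + ?\<tau> a, t := ?\<tau> t + ?\<tau> a))"
    using Suc.prems by (intro Suc.hyps(1)) auto
  moreover have "?\<tau>(a := 0, b := ?\<tau> b + ?\<tau> a, t := ?\<tau> t + ?\<tau> a)
      = \<sigma>(a := 0, b := \<sigma> b + \<sigma> a, t := \<sigma> t + \<sigma> a)"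
    using Suc.hyps(2)[symmetric] Suc.prems by (intro ext) auto
  moreover have "big (Seq (INC b) (INC t)) (\<sigma>(a := n)) ?\<tau>"
    using Seq[OF INC[of b "\<sigma>(a := n)"] INC[of t]] Suc.prems by simp
  ultimately show ?case using Loop_Suc[of \<sigma> a n, OF Suc.hyps(2)[symmetric]] by metis
qed

lemma big_copy:
  assumes "a \<noteq> b" "a \<noteq> t" "b \<noteq> t"
  shows "big (copy a b t) \<sigma> (\<sigma>(b := \<sigma> a, t := 0))"
proof -
  let ?\<sigma>1 = "\<sigma>(b := 0, t := 0)"
  let ?\<sigma>2 = "?\<sigma>1(a := 0, b := ?\<sigma>1 b + ?\<sigma>1 a, t := ?\<sigma>1 t + ?\<sigma>1 a)"
  have "big (copy a b t) \<sigma> (?\<sigma>2(t := 0, a := ?\<sigma>2 a + ?\<sigma>2 t))"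
    unfolding copy_def using assms
    by (intro Seq[OF CLR Seq[OF CLR Seq[OF big_Loop_move2 big_Loop_move]]]) auto
  moreover have "?\<sigma>2(t := 0, a := ?\<sigma>2 a + ?\<sigma>2 t) = \<sigma>(b := \<sigma> a, t := 0)"
    using assms by auto
  ultimately show ?thesis by simp
qed

text \<open>The command \<open>compile f args n\<close> reads its arguments in the registers \<open>args\<close>, writes the value
  to register \<open>n\<close>, and uses the registers above \<open>n\<close> as scratch space.\<close>

fun compile :: "recf \<Rightarrow> nat list \<Rightarrow> nat \<Rightarrow> com"
  and compile_list :: "recf list \<Rightarrow> nat list \<Rightarrow> nat \<Rightarrow> com" where
  "compile Zero as n = CLR n"
| "compile Succ as n = Seq (copy (hd as) n (n + 1)) (INC n)"
| "compile (Proj i) as n = copy (as ! i) n (n + 1)"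
| "compile (Comp f gs) as n =
    (let m = n + 1 + length gs
     in Seq (compile_list gs as (n + 1)) (Seq (compile f [n + 1..<m] m) (copy m n (m + 1))))"
| "compile (PrimRec f g) as n =
    Seq (Seq (compile f (tl as) (n + 3)) (copy (n + 3) n (n + 4)))
    (Seq (Seq (CLR (n + 1)) (copy (hd as) (n + 2) (n + 3)))
      (Loop (n + 2) (Seq (compile g ((n + 1) # n # tl as) (n + 3))
        (Seq (copy (n + 3) n (n + 4)) (INC (n + 1))))))"
| "compile (Mu f) as n =
    Seq (Seq (CLR n) (compile f (n # as) (n + 1)))
      (Loop (n + 1) (Seq (INC n) (compile f (n # as) (n + 1))))"
| "compile_list [] as n = CLR n"
| "compile_list (g # gs) as n = Seq (compile g as n) (compile_list gs as (n + 1))"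

definition computes :: "com \<Rightarrow> nat \<Rightarrow> (nat \<Rightarrow> nat) \<Rightarrow> nat \<Rightarrow> bool" where
  "computes c n \<sigma> y \<longleftrightarrow> (\<exists>\<tau>. big c \<sigma> \<tau> \<and> \<tau> n = y \<and> (\<forall>r<n. \<tau> r = \<sigma> r))"

text \<open>The converse, divergence of the command where \<open>f\<close> is undefined, is not needed: unbounded search
  happens only in the outermost loop, over a total function.\<close>

definition compiled :: "recf \<Rightarrow> bool" where
  "compiled f \<longleftrightarrow> (\<forall>as n \<sigma> y. set as \<subseteq> {..<n} \<longrightarrow> evaluates f (map \<sigma> as) y \<longrightarrow>
    computes (compile f as n) n \<sigma> y)"

lemma compiledD:
  assumes "compiled f" "evaluates f xs y" "set as \<subseteq> {..<n}" "map \<sigma> as = xs"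
  obtains \<tau> where "big (compile f as n) \<sigma> \<tau>" "\<tau> n = y" "\<And>r. r < n \<Longrightarrow> \<tau> r = \<sigma> r"
  using assms unfolding compiled_def computes_def by blast

lemma compile_list_correct:
  assumes "\<And>g. g \<in> set gs \<Longrightarrow> compiled g" "list_all2 (\<lambda>g y. evaluates g xs y) gs ys"
    "set as \<subseteq> {..<n}" "map \<sigma> as = xs"
  shows "\<exists>\<tau>. big (compile_list gs as n) \<sigma> \<tau> \<and> map \<tau> [n..<n + length gs] = ys \<and>
    (\<forall>r<n. \<tau> r = \<sigma> r)"
  using assms
proof (induction gs arbitrary: n \<sigma> ys)
  case Nil
  \<comment> \<open>Commands have no empty program; clearing the scratch register \<open>n\<close>
    stands in for it.\<close>
  then show ?case by (auto intro!: exI CLR)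
next
  case (Cons g gs)
  then obtain y zs where ys: "ys = y # zs" "evaluates g xs y"
      "list_all2 (\<lambda>g y. evaluates g xs y) gs zs"
    by (auto simp: list_all2_Cons1)
  obtain \<tau> where \<tau>: "big (compile g as n) \<sigma> \<tau>" "\<tau> n = y" "\<And>r. r < n \<Longrightarrow> \<tau> r = \<sigma> r"
    using compiledD[OF Cons.prems(1) ys(2) Cons.prems(3,4)] by auto
  have "\<exists>\<rho>. big (compile_list gs as (n + 1)) \<tau> \<rho> \<and> map \<rho> [n + 1..<n + 1 + length gs] = zs \<and>
      (\<forall>r<n + 1. \<rho> r = \<tau> r)"
  proof (rule Cons.IH)
    show "map \<tau> as = xs" using Cons.prems(3,4) \<tau>(3) by (auto intro!: map_cong)
    show "set as \<subseteq> {..<n + 1}" using Cons.prems(3) by auto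
  qed (use Cons.prems ys in auto)
  then obtain \<rho> where \<rho>: "big (compile_list gs as (n + 1)) \<tau> \<rho>"
    "map \<rho> [n + 1..<n + 1 + length gs] = zs" "\<And>r. r < n + 1 \<Longrightarrow> \<rho> r = \<tau> r" by blast
  have "[n..<n + length (g # gs)] = n # [n + 1..<n + 1 + length gs]"
    by (subst upt_conv_Cons) auto
  then have "map \<rho> [n..<n + length (g # gs)] = ys"
    using \<rho>(2) \<rho>(3)[of n] \<tau>(2) ys(1) by (simp del: upt_Suc)
  then show ?case using Seq[OF \<tau>(1) \<rho>(1)] \<tau>(3) \<rho>(3)
    by (auto intro!: exI[of _ \<rho>])
qed

inductive_cases evaluates_Zero: "evaluates Zero xs y"
inductive_cases evaluates_Succ: "evaluates Succ xs y"
inductive_cases evaluates_Proj: "evaluates (Proj i) xs y"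
inductive_cases evaluates_Comp: "evaluates (Comp f gs) xs y"
inductive_cases evaluates_PrimRec: "evaluates (PrimRec f g) xs y"
inductive_cases evaluates_PrimRec_0: "evaluates (PrimRec f g) (0 # xs) y"
inductive_cases evaluates_PrimRec_Suc: "evaluates (PrimRec f g) (Suc n # xs) y"
inductive_cases evaluates_Mu: "evaluates (Mu f) xs y"

text \<open>The rules unfold primitive recursion from the top, whereas the compiled loop runs
  upwards. The sequence \<open>v\<close> of intermediate values links the two.\<close>

lemma evaluates_PrimRec_values:
  assumes "evaluates (PrimRec f g) (a # xs) y"
  obtains v where "evaluates f xs (v 0)" "v a = y"
    "\<And>i. i < a \<Longrightarrow> evaluates g (i # v i # xs) (v (Suc i))"
  using assms
proof (induction a arbitrary: y thesis)
  case 0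
  from 0(2) have "evaluates f xs y" by (rule evaluates_PrimRec_0)
  then show ?case using 0(1)[of "\<lambda>_. y"] by simp
next
  case (Suc a)
  from Suc(3) obtain r where r: "evaluates (PrimRec f g) (a # xs) r" "evaluates g (a # r # xs) y"
    by (rule evaluates_PrimRec_Suc)
  obtain v where v: "evaluates f xs (v 0)" "v a = r"
    "\<And>i. i < a \<Longrightarrow> evaluates g (i # v i # xs) (v (Suc i))"
    using Suc(1) r(1) by blast
  show ?case
    by (rule Suc(2)[of "v(Suc a := y)"]) (use v r in \<open>auto simp: less_Suc_eq\<close>)
qed

lemma compiled_Comp:
  assumes "compiled f" "\<And>g. g \<in> set gs \<Longrightarrow> compiled g"
  shows "compiled (Comp f gs)"
  unfolding compiled_def
proof (intro allI impI)
  fix as :: "nat list" and n \<sigma> y assume as: "set as \<subseteq> {..<n}" and "evaluates (Comp f gs) (map \<sigma> as) y"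
  then obtain ys where ys: "list_all2 (\<lambda>g y. evaluates g (map \<sigma> as) y) gs ys" "evaluates f ys y"
    by (auto elim: evaluates_Comp)
  define m where "m = n + 1 + length gs"
  have "set as \<subseteq> {..<n + 1}" using as by auto
  then obtain \<tau> where \<tau>: "big (compile_list gs as (n + 1)) \<sigma> \<tau>" "map \<tau> [n + 1..<m] = ys"
    "\<And>r. r < n + 1 \<Longrightarrow> \<tau> r = \<sigma> r"
    using compile_list_correct[OF assms(2) ys(1), of as "n + 1" \<sigma>] unfolding m_def by blast
  have sub: "set [n + 1..<m] \<subseteq> {..<m}" by auto
  obtain \<rho> where \<rho>: "big (compile f [n + 1..<m] m) \<tau> \<rho>" "\<rho> m = y" "\<And>r. r < m \<Longrightarrow> \<rho> r = \<tau> r"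
    using compiledD[OF assms(1) ys(2) sub \<tau>(2)] by blast
  have copy: "big (copy m n (m + 1)) \<rho> (\<rho>(n := \<rho> m, m + 1 := 0))"
    by (rule big_copy) (auto simp: m_def)
  have "big (compile (Comp f gs) as n) \<sigma> (\<rho>(n := \<rho> m, m + 1 := 0))"
    unfolding compile.simps Let_def m_def[symmetric] by (rule Seq[OF \<tau>(1) Seq[OF \<rho>(1) copy]])
  then show "computes (compile (Comp f gs) as n) n \<sigma> y"
    using \<rho>(2,3) \<tau>(3) unfolding computes_def
    by (auto intro!: exI[of _ "\<rho>(n := \<rho> m, m + 1 := 0)"] simp: m_def)
qed

lemma compiled_PrimRec:
  assumes "compiled f" "compiled g"
  shows "compiled (PrimRec f g)"
  unfolding compiled_def
proof (intro allI impI)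
  fix as :: "nat list" and n \<sigma> y assume as: "set as \<subseteq> {..<n}" and ev: "evaluates (PrimRec f g) (map \<sigma> as) y"
  then obtain a bs where ab: "as = a # bs" by (cases as) (auto elim: evaluates_PrimRec)
  obtain v where v: "evaluates f (map \<sigma> bs) (v 0)" "v (\<sigma> a) = y"
    "\<And>i. i < \<sigma> a \<Longrightarrow> evaluates g (i # v i # map \<sigma> bs) (v (Suc i))"
    using ev ab by (auto elim: evaluates_PrimRec_values)
  have bs: "set bs \<subseteq> {..<n}" "a < n" using as ab by auto
  define body where "body = Seq (compile g ((n + 1) # n # bs) (n + 3))
    (Seq (copy (n + 3) n (n + 4)) (INC (n + 1)))"
  \<comment> \<open>Loop invariant: register \<open>n\<close> holds the value \<open>v j\<close>,
    register \<open>n + 1\<close> the number \<open>j\<close> of rounds done, and register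
    \<open>n + 2\<close> the number \<open>k\<close> of rounds left.\<close>
  have loop: "\<exists>\<rho>. big (Loop (n + 2) body) \<tau> \<rho> \<and> \<rho> n = v (j + k) \<and> (\<forall>r<n. \<rho> r = \<tau> r)"
    if "\<tau> (n + 2) = k" "\<tau> (n + 1) = j" "\<tau> n = v j" "\<And>r. r < n \<Longrightarrow> \<tau> r = \<sigma> r" "j + k \<le> \<sigma> a"
    for \<tau> j k
    using that
  proof (induction k arbitrary: \<tau> j)
    case 0
    then show ?case by (auto intro!: exI[of _ \<tau>] Loop_0)
  next
    case (Suc k)
    have m: "map (\<tau>(n + 2 := k)) ((n + 1) # n # bs) = j # v j # map \<sigma> bs"
      using Suc.prems bs by (auto simp: subset_iff)
    have e: "evaluates g (j # v j # map \<sigma> bs) (v (Suc j))" using v(3) Suc.prems by simp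
    have sub: "set ((n + 1) # n # bs) \<subseteq> {..<n + 3}" using bs by auto
    obtain \<rho> where \<rho>: "big (compile g ((n + 1) # n # bs) (n + 3)) (\<tau>(n + 2 := k)) \<rho>"
      "\<rho> (n + 3) = v (Suc j)" "\<And>r. r < n + 3 \<Longrightarrow> \<rho> r = (\<tau>(n + 2 := k)) r"
      using compiledD[OF assms(2) e sub m] by blast
    let ?\<rho>' = "\<rho>(n := \<rho> (n + 3), n + 4 := 0)"
    let ?\<rho>'' = "?\<rho>'(n + 1 := Suc (?\<rho>' (n + 1)))"
    have body: "big body (\<tau>(n + 2 := k)) ?\<rho>''"
      unfolding body_def by (intro Seq[OF \<rho>(1) Seq[OF big_copy INC]]) auto
    have "\<exists>\<rho>. big (Loop (n + 2) body) ?\<rho>'' \<rho> \<and> \<rho> n = v (Suc j + k) \<and> (\<forall>r<n. \<rho> r = ?\<rho>'' r)"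
      using Suc.prems \<rho>(2,3) by (intro Suc.IH) auto
    then obtain \<upsilon> where "big (Loop (n + 2) body) ?\<rho>'' \<upsilon>" "\<upsilon> n = v (Suc j + k)"
      "\<And>r. r < n \<Longrightarrow> \<upsilon> r = ?\<rho>'' r" by blast
    then show ?case using Loop_Suc[of \<tau> "n + 2" k, OF Suc.prems(1) body] Suc.prems \<rho>(3)
      by (auto intro!: exI[of _ \<upsilon>])
  qed
  have "set bs \<subseteq> {..<n + 3}" using bs(1) by auto
  then obtain \<tau> where \<tau>: "big (compile f bs (n + 3)) \<sigma> \<tau>" "\<tau> (n + 3) = v 0"
    "\<And>r. r < n + 3 \<Longrightarrow> \<tau> r = \<sigma> r"
    using compiledD[OF assms(1) v(1), of bs "n + 3" \<sigma>] by auto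
  let ?\<tau>1 = "\<tau>(n := \<tau> (n + 3), n + 4 := 0)"
  let ?\<tau>2 = "?\<tau>1(n + 1 := 0)"
  let ?\<tau>3 = "?\<tau>2(n + 2 := ?\<tau>2 a, n + 3 := 0)"
  have init: "big (Seq (compile f bs (n + 3)) (copy (n + 3) n (n + 4))) \<sigma> ?\<tau>1"
    by (intro Seq[OF \<tau>(1) big_copy]) auto
  have count: "big (Seq (CLR (n + 1)) (copy a (n + 2) (n + 3))) ?\<tau>1 ?\<tau>3"
    using bs(2) by (intro Seq[OF CLR big_copy]) auto
  have "\<exists>\<rho>. big (Loop (n + 2) body) ?\<tau>3 \<rho> \<and> \<rho> n = v (0 + \<sigma> a) \<and> (\<forall>r<n. \<rho> r = ?\<tau>3 r)"
    using \<tau>(2,3) bs(2) by (intro loop) auto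
  then obtain \<rho> where \<rho>: "big (Loop (n + 2) body) ?\<tau>3 \<rho>" "\<rho> n = y" "\<And>r. r < n \<Longrightarrow> \<rho> r = ?\<tau>3 r"
    using v(2) by auto
  have "big (compile (PrimRec f g) as n) \<sigma> \<rho>"
    unfolding ab compile.simps list.sel body_def[symmetric]
    by (rule Seq[OF init Seq[OF count \<rho>(1)]])
  then show "computes (compile (PrimRec f g) as n) n \<sigma> y"
    using \<rho>(2,3) \<tau>(3) unfolding computes_def by (auto intro!: exI[of _ \<rho>])
qed

lemma compiled_Mu:
  assumes "compiled f"
  shows "compiled (Mu f)"
  unfolding compiled_def
proof (intro allI impI)
  fix as :: "nat list" and n \<sigma> y assume as: "set as \<subseteq> {..<n}" and "evaluates (Mu f) (map \<sigma> as) y"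
  then have y: "evaluates f (y # map \<sigma> as) 0"
    "\<And>m. m < y \<Longrightarrow> \<exists>z>0. evaluates f (m # map \<sigma> as) z"
    by (auto elim: evaluates_Mu)
  have run: "\<exists>\<rho>. big (compile f (n # as) (n + 1)) \<tau> \<rho> \<and> \<rho> (n + 1) = z \<and> (\<forall>r<n + 1. \<rho> r = \<tau> r)"
    if "evaluates f (\<tau> n # map \<sigma> as) z" "\<And>r. r < n \<Longrightarrow> \<tau> r = \<sigma> r" for \<tau> z
  proof -
    have "set (n # as) \<subseteq> {..<n + 1}" "map \<tau> (n # as) = \<tau> n # map \<sigma> as"
      using as that(2) by (auto simp: subset_iff)
    then show ?thesis using compiledD[OF assms that(1)] by metis
  qed
  let ?body = "Seq (INC n) (compile f (n # as) (n + 1))"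
  \<comment> \<open>Register \<open>n\<close> holds the candidate \<open>m\<close> and register
    \<open>n + 1\<close> the value of \<open>f\<close> there. The loop test decrements that value,
    but the body computes it afresh for the next candidate.\<close>
  have loop: "\<exists>\<rho>. big (Loop (n + 1) ?body) \<tau> \<rho> \<and> \<rho> n = y \<and> (\<forall>r<n. \<rho> r = \<sigma> r)"
    if "\<tau> n = m" "m \<le> y" "evaluates f (m # map \<sigma> as) (\<tau> (n + 1))" "\<And>r. r < n \<Longrightarrow> \<tau> r = \<sigma> r" for \<tau> m
    using that
  proof (induction "y - m" arbitrary: \<tau> m)
    case 0
    then have "m = y" by simp
    then have "\<tau> (n + 1) = 0" using evaluates_deterministic[OF y(1)] 0 by simp
    then have "big (Loop (n + 1) ?body) \<tau> \<tau>" by (rule Loop_0)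
    then show ?case using 0 \<open>m = y\<close> by blast
  next
    case (Suc d)
    then have "m < y" by simp
    then obtain z where z: "\<tau> (n + 1) = Suc z"
      using y(2) evaluates_deterministic Suc.prems(3) by (metis gr0_implies_Suc)
    let ?\<tau> = "\<tau>(n + 1 := z)"
    let ?\<tau>' = "?\<tau>(n := Suc (?\<tau> n))"
    obtain w where w: "evaluates f (Suc m # map \<sigma> as) w"
      using y \<open>m < y\<close> by (metis Suc_lessI)
    obtain \<rho> where \<rho>: "big (compile f (n # as) (n + 1)) ?\<tau>' \<rho>" "\<rho> (n + 1) = w"
      "\<And>r. r < n + 1 \<Longrightarrow> \<rho> r = ?\<tau>' r"
      using run[of ?\<tau>' w] w Suc.prems by auto
    have "\<exists>\<upsilon>. big (Loop (n + 1) ?body) \<rho> \<upsilon> \<and> \<upsilon> n = y \<and> (\<forall>r<n. \<upsilon> r = \<sigma> r)"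
      by (rule Suc.hyps(1)[of "Suc m"]) (use Suc \<rho> w \<open>m < y\<close> in auto)
    then show ?case using Loop_Suc[of \<tau> "n + 1" z, OF z Seq[OF INC \<rho>(1)]] by blast
  qed
  let ?\<sigma> = "\<sigma>(n := 0)"
  obtain w where w: "evaluates f (0 # map \<sigma> as) w" using y by (metis gr0I)
  then obtain \<rho> where \<rho>: "big (compile f (n # as) (n + 1)) ?\<sigma> \<rho>" "\<rho> (n + 1) = w"
      "\<And>r. r < n + 1 \<Longrightarrow> \<rho> r = ?\<sigma> r"
    using run[of ?\<sigma> w] by auto
  obtain \<upsilon> where "big (Loop (n + 1) ?body) \<rho> \<upsilon>" "\<upsilon> n = y" "\<forall>r<n. \<upsilon> r = \<sigma> r"
    using loop[of \<rho> 0] w \<rho> by auto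
  then show "computes (compile (Mu f) as n) n \<sigma> y"
    using Seq[OF Seq[OF CLR \<rho>(1)]] unfolding computes_def by auto
qed

lemma compiled: "compiled f"
proof (induction f)
  case Zero
  show ?case unfolding compiled_def computes_def
    by (auto elim!: evaluates_Zero intro!: exI CLR)
next
  case Succ
  show ?case unfolding compiled_def
  proof (intro allI impI)
    fix as :: "nat list" and n \<sigma> y assume "set as \<subseteq> {..<n}" "evaluates Succ (map \<sigma> as) y"
    then obtain a where a: "as = [a]" "y = Suc (\<sigma> a)" "a < n"
      by (auto elim!: evaluates_Succ)
    let ?\<tau> = "\<sigma>(n := \<sigma> a, n + 1 := 0)"
    have "big (compile Succ as n) \<sigma> (?\<tau>(n := Suc (?\<tau> n)))"
      using a Seq[OF big_copy[of a n "n + 1"] INC[of n]] by simp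
    then show "computes (compile Succ as n) n \<sigma> y"
      using a unfolding computes_def by fastforce
  qed
next
  case (Proj i)
  show ?case unfolding compiled_def
  proof (intro allI impI)
    fix as :: "nat list" and n \<sigma> y assume as: "set as \<subseteq> {..<n}" and "evaluates (Proj i) (map \<sigma> as) y"
    then have i: "i < length as" "y = \<sigma> (as ! i)" by (auto elim!: evaluates_Proj)
    then have "as ! i < n" using as nth_mem by blast
    then have "big (compile (Proj i) as n) \<sigma> (\<sigma>(n := \<sigma> (as ! i), n + 1 := 0))"
      by (auto intro!: big_copy)
    then show "computes (compile (Proj i) as n) n \<sigma> y"
      using i unfolding computes_def by fastforce
  qed
qed (auto intro: compiled_Comp compiled_PrimRec compiled_Mu)

section \<open>Assembling structured commands into instruction lists\<close>

fun com_size :: "com \<Rightarrow> nat" where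
  "com_size (Seq c d) = com_size c + com_size d"
| "com_size (Loop r c) = Suc (com_size c)"
| "com_size _ = 1"

text \<open>Here \<open>s\<close> is the address of the first instruction and \<open>e\<close> the
  label where control continues. Jumps are absolute, hence the need for
  \<open>com_size\<close>.\<close>

fun assemble :: "com \<Rightarrow> nat \<Rightarrow> nat \<Rightarrow> instr list" where
  "assemble (INC r) s e = [Inc r e]"
| "assemble (CLR r) s e = [Dec r s e]"
| "assemble (Seq c d) s e =
    assemble c s (s + com_size c) @ assemble d (s + com_size c) e"
| "assemble (Loop r c) s e = Dec r (s + 1) e # assemble c (s + 1) s"

lemma length_assemble [simp]: "length (assemble c s e) = com_size c"
  by (induction c arbitrary: s e) auto

definition block :: "instr list \<Rightarrow> nat \<Rightarrow> instr list \<Rightarrow> bool" where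
  "block P s as \<longleftrightarrow> (\<exists>us vs. P = us @ as @ vs \<and> length us = s)"

lemma block_append:
  assumes "block P s (as @ bs)"
  shows "block P s as" "block P (s + length as) bs"
  using assms unfolding block_def by auto (metis append.assoc length_append)

lemma block_Cons:
  assumes "block P s (a # as)"
  shows "s < length P" "P ! s = a" "block P (s + 1) as"
proof -
  obtain us vs where P: "P = us @ (a # as) @ vs" "length us = s"
    using assms unfolding block_def by blast
  then show "s < length P" "P ! s = a" by auto
  show "block P (s + 1) as" using assms block_append(2)[of P s "[a]" as] by simp
qed

text \<open>At least one step is demanded, so that \<open>k\<close> rounds of a loop take at least
  \<open>k\<close> steps. This gives divergence in \<open>ex_minsky\<close> without analysing
  diverging commands.\<close>

definition reaches :: "instr list \<Rightarrow> nat \<times> (nat \<Rightarrow> nat) \<Rightarrow> nat \<times> (nat \<Rightarrow> nat) \<Rightarrow> bool" where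
  "reaches P c d \<longleftrightarrow> (\<exists>n>0. (minsky_step P ^^ n) c = d)"

lemma reaches_trans: "reaches P c d \<Longrightarrow> reaches P d e \<Longrightarrow> reaches P c e"
  unfolding reaches_def
  by (metis add_gr_0 comp_apply funpow_add)

lemma reaches_step: "minsky_step P c = d \<Longrightarrow> reaches P c d"
  unfolding reaches_def by (auto intro!: exI[of _ 1])

lemma reaches_CLR:
  assumes "s < length P" "P ! s = Dec r s e"
  shows "reaches P (s, \<sigma>) (e, \<sigma>(r := 0))"
proof (induction "\<sigma> r" arbitrary: \<sigma>)
  case 0
  then show ?case using assms by (intro reaches_step) (simp add: minsky_step_def fun_upd_idem)
next
  case (Suc n)
  have "reaches P (s, \<sigma>) (s, \<sigma>(r := n))"
    using Suc assms by (intro reaches_step) (auto simp: minsky_step_def Suc(2)[symmetric])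
  then show ?case using Suc(1)[of "\<sigma>(r := n)"] reaches_trans by fastforce
qed

lemma reaches_assemble:
  "big c \<sigma> \<tau> \<Longrightarrow> block P s (assemble c s e) \<Longrightarrow> reaches P (s, \<sigma>) (e, \<tau>)"
proof (induction arbitrary: s e rule: big.induct)
  case (INC r \<sigma>)
  then show ?case using block_Cons(1,2)[of P s "Inc r e" "[]"]
    by (intro reaches_step) (simp add: minsky_step_def fun_upd_def)
next
  case (CLR r \<sigma>)
  then show ?case using block_Cons(1,2)[of P s "Dec r s e" "[]"]
    by (intro reaches_CLR) simp_all
next
  case (Seq c \<sigma> \<tau> d \<rho>)
  then show ?case using block_append[of P s "assemble c s (s + com_size c)"] reaches_trans
    by fastforce
next
  case (Loop_0 \<sigma> r c)
  then show ?case using block_Cons(1,2)[OF Loop_0.prems[unfolded assemble.simps]]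
    by (intro reaches_step) (simp add: minsky_step_def)
next
  case (Loop_Suc \<sigma> r n c \<tau> \<rho>)
  note b = block_Cons[OF Loop_Suc.prems[unfolded assemble.simps]]
  have "reaches P (s, \<sigma>) (s + 1, \<sigma>(r := n))"
    using b Loop_Suc.hyps(1) by (intro reaches_step) (simp add: minsky_step_def)
  then show ?case using Loop_Suc.IH b(3) Loop_Suc.prems reaches_trans by meson
qed

text \<open>The machine evaluates \<open>H 0 n\<close>, \<open>H 1 n\<close>, and so on until it
  meets the value \<open>0\<close>. Since \<open>H\<close> is total, every evaluation terminates and
  only the outer search can run forever.\<close>

lemma ex_minsky:
  assumes "computable 2 (\<lambda>xs. H (xs ! 0) (xs ! 1))"
  shows "\<exists>P. \<forall>n. halts P (input n) \<longleftrightarrow> (\<exists>k. H k n = 0)"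
proof -
  obtain h where h: "\<And>k n. evaluates h [k, n] (H k n)"
    using assms unfolding computable_def
    by (metis length_Cons list.size(3) nth_Cons_0 nth_Cons_Suc One_nat_def numeral_2_eq_2)
  \<comment> \<open>Register \<open>0\<close> keeps \<open>n\<close>, register \<open>1\<close> the
    candidate \<open>k\<close>, and register \<open>2\<close> receives \<open>H k n\<close>.\<close>
  define c where "c = compile h [1, 0] 2"
  \<comment> \<open>The contents \<open>\<sigma>\<close> are arbitrary, so scratch values left by
    earlier rounds do no harm.\<close>
  have c: "\<exists>\<tau>. big c \<sigma> \<tau> \<and> \<tau> 0 = \<sigma> 0 \<and> \<tau> 1 = \<sigma> 1 \<and> \<tau> 2 = H (\<sigma> 1) (\<sigma> 0)" for \<sigma>
    using compiledD[OF compiled h, of "[1, 0]" 2 \<sigma>] unfolding c_def by fastforce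
  define prog where "prog = Seq c (Loop 2 (Seq (INC 1) c))"
  define L where "L = com_size prog"
  define s where "s = com_size c"
  define P where "P = assemble prog 0 L"
  have L: "length P = L" by (simp add: P_def L_def)
  have sL: "s < L" by (simp add: s_def L_def prog_def)
  have "block P 0 (assemble c 0 s @ assemble (Loop 2 (Seq (INC 1) c)) s L)"
    unfolding block_def by (auto simp: P_def prog_def s_def)
  note block = block_append[OF this]
  have block_c: "block P 0 (assemble c 0 s)" by (rule block)
  have "block P s (assemble (Loop 2 (Seq (INC 1) c)) s L)" using block(2) by (simp add: s_def)
  then have head: "s < length P" "P ! s = Dec 2 (s + 1) L"
    and body: "block P (s + 1) (assemble (Seq (INC 1) c) (s + 1) s)"
    by (auto dest: block_Cons)
  have search: "\<exists>\<tau>. reaches P (input n) (s, \<tau>) \<and> \<tau> 0 = n \<and> \<tau> 1 = k \<and> \<tau> 2 = H k n \<and>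
      (\<exists>m\<ge>k. (minsky_step P ^^ m) (input n) = (s, \<tau>))"
    if "\<And>i. i < k \<Longrightarrow> H i n \<noteq> 0" for n k
    using that
  proof (induction k)
    case 0
    obtain \<tau> where "big c (snd (input n)) \<tau>" "\<tau> 0 = n" "\<tau> 1 = 0" "\<tau> 2 = H 0 n"
      using c[of "snd (input n)"] by (auto simp: input_def)
    then show ?case using reaches_assemble[OF _ block_c, of "snd (input n)" \<tau>]
      by (auto simp: input_def reaches_def)
  next
    case (Suc k)
    then obtain \<tau> m where \<tau>: "reaches P (input n) (s, \<tau>)" "\<tau> 0 = n" "\<tau> 1 = k" "\<tau> 2 = H k n"
      and m: "m \<ge> k" "(minsky_step P ^^ m) (input n) = (s, \<tau>)" by auto
    from Suc.prems obtain x where x: "H k n = Suc x" by (metis lessI not0_implies_Suc)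
    let ?\<tau> = "\<tau>(2 := x)"
    let ?\<tau>' = "?\<tau>(1 := Suc (?\<tau> 1))"
    obtain \<rho> where \<rho>: "big c ?\<tau>' \<rho>" "\<rho> 0 = n" "\<rho> 1 = Suc k" "\<rho> 2 = H (Suc k) n"
      using c[of ?\<tau>'] \<tau> by auto
    have "reaches P (s, \<tau>) (s + 1, ?\<tau>)"
      using head \<tau>(4) x by (intro reaches_step) (simp add: minsky_step_def)
    then have r: "reaches P (s, \<tau>) (s, \<rho>)"
      using reaches_assemble[OF Seq[OF INC \<rho>(1)] body] reaches_trans by blast
    then obtain l where l: "l > 0" "(minsky_step P ^^ l) (s, \<tau>) = (s, \<rho>)"
      by (auto simp: reaches_def)
    have "(minsky_step P ^^ (l + m)) (input n) = (s, \<rho>)" "l + m \<ge> Suc k"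
      using m l by (auto simp: funpow_add)
    then show ?case using reaches_trans[OF \<tau>(1) r] \<rho> by blast
  qed
  have "halts P (input n) \<longleftrightarrow> (\<exists>k. H k n = 0)" for n
  proof
    assume "\<exists>k. H k n = 0"
    then obtain k where k: "H k n = 0" "\<And>i. i < k \<Longrightarrow> H i n \<noteq> 0"
      using exists_least_iff[of "\<lambda>k. H k n = 0"] by blast
    then obtain \<tau> where \<tau>: "reaches P (input n) (s, \<tau>)" "\<tau> 2 = 0" using search[OF k(2)] by metis
    have "reaches P (s, \<tau>) (L, \<tau>)"
      using head \<tau>(2) by (intro reaches_step) (simp add: minsky_step_def)
    then have "reaches P (input n) (L, \<tau>)" using \<tau>(1) reaches_trans by blast
    then show "halts P (input n)" unfolding halts_def reaches_def L by (metis fst_conv order_refl)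
  next
    assume "halts P (input n)"
    then obtain k where k: "length P \<le> fst ((minsky_step P ^^ k) (input n))"
      unfolding halts_def by blast
    have "minsky_step P ((minsky_step P ^^ k) (input n)) = (minsky_step P ^^ k) (input n)"
      using k by (simp add: minsky_step_def)
    \<comment> \<open>After halting the configuration is constant. Without a zero of
      \<open>H\<close> the loop head \<open>s\<close>, which lies inside the program, would be
      visited at some time \<open>m \<ge> k\<close>: a contradiction.\<close>
    then have stay: "(minsky_step P ^^ (j + k)) (input n) = (minsky_step P ^^ k) (input n)" for j
      by (induction j) auto
    show "\<exists>k. H k n = 0"
    proof (rule ccontr)
      assume "\<not> (\<exists>k. H k n = 0)"
      then obtain \<tau> m where "m \<ge> k" "(minsky_step P ^^ m) (input n) = (s, \<tau>)"
        using search[of k n] by auto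
      then have "(minsky_step P ^^ k) (input n) = (s, \<tau>)"
        using stay[of "m - k"] by simp
      then show False using k sL L by simp
    qed
  qed
  then show ?thesis by blast
qed

theorem minsky_halting_undecidable: "\<exists>P. \<not> recursive_set {n. halts P (input n)}"
proof -
  obtain P where P: "\<And>n. halts P (input n) \<longleftrightarrow> n \<in> universal_halting_set"
    using ex_minsky[of "\<lambda>k e. grest e k"] computable_grest
    unfolding universal_halting_set_def by auto
  have "\<not> recursive_set {n. halts P (input n)}"
  proof
    assume "recursive_set {n. halts P (input n)}"
    then have "computable 1 (\<lambda>xs. if xs ! 0 \<in> universal_halting_set then 1 else 0)"
      by (simp add: P recursive_set_iff_computable)
    then have "computable 2 (\<lambda>xs. if xs ! 1 \<in> universal_halting_set then 1 else 0)"
      by (rule computable_comp1[where F = "\<lambda>n. if n \<in> universal_halting_set then 1 else 0"])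
        (simp add: computable_nth)
    \<comment> \<open>If the set were decidable, a search whose test does not depend on
      \<open>k\<close> would give a machine halting exactly on its complement.\<close>
    then obtain Q where Q: "\<And>n. halts Q (input n) \<longleftrightarrow> n \<notin> universal_halting_set"
      using ex_minsky[of "\<lambda>k n. if n \<in> universal_halting_set then 1 else 0"]
      by (metis zero_neq_one)
    then show False using ex_code_halts[of Q] by blast
  qed
  then show ?thesis ..
qed

section \<open>Simulating a Minsky machine by tree automorphisms\<close>

datatype sym = One | A | T nat | B nat

definition tr :: "nat \<Rightarrow> nat \<Rightarrow> nat \<Rightarrow> nat" where
  "tr a b c = (if c = a then b else if c = b then a else c)"

text \<open>At an instruction \<open>Inc i k\<close> the product of the \<open>t\<^sub>l\<close> has a section with the factors \<open>l \<ge> i\<close> at letter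
  \<open>0\<close> and one with the factors \<open>l \<le> i\<close> at letter \<open>2\<close>. Composing the second after the first doubles
  the power of \<open>t\<^sub>i\<close> and keeps the others, although the \<open>t\<^sub>l\<close> need not commute. At \<open>Dec i k k'\<close> the
  exponent \<open>n\<close> of \<open>t\<^sub>i\<close> turns into \<open>n / 2\<close> rounded up at letter \<open>0\<close>, so that \<open>n = 1\<close>, which represents an
  empty register, is preserved, and the parity of \<open>n\<close> selects the letter that is reached.\<close>

fun local_out :: "instr \<Rightarrow> nat \<Rightarrow> sym \<Rightarrow> nat \<Rightarrow> nat" where
  "local_out (Inc i k) j A c = tr 1 2 c"
| "local_out (Inc i k) j (B l) c = (if l = j then tr 0 1 (tr 2 3 c) else c)"
| "local_out (Dec i k k') j (T l) c = (if l = i then tr 0 1 c else c)"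
| "local_out (Dec i k k') j (B l) c = (if l = j then tr 0 2 (tr 1 3 c) else c)"
| "local_out _ _ _ c = c"

fun local_sec :: "instr \<Rightarrow> sym \<Rightarrow> nat \<Rightarrow> sym" where
  "local_sec (Inc i k) A c = (if c = 0 then A else if c = 3 then B k else One)"
| "local_sec (Inc i k) (T l) c = (if c = 0 \<and> i \<le> l \<or> c = 2 \<and> l \<le> i then T l else One)"
| "local_sec (Dec i k k') A c =
    (if c = 0 then A else if c = 2 then B k else if c = 3 then B k' else One)"
| "local_sec (Dec i k k') (T l) c = (if c = 0 \<or> c = 1 \<and> l \<noteq> i then T l else One)"
| "local_sec _ _ _ = One"

text \<open>The letter \<open>4 * j + c\<close> is the \<open>c\<close>-th of the four letters of
  instruction \<open>j\<close>. Letters beyond the program are fixed and have the trivial section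
  \<open>One\<close>.\<close>

definition out :: "instr list \<Rightarrow> sym \<Rightarrow> nat \<Rightarrow> nat" where
  "out P q x = (if x div 4 < length P
    then 4 * (x div 4) + local_out (P ! (x div 4)) (x div 4) q (x mod 4) else x)"

definition sec :: "instr list \<Rightarrow> sym \<Rightarrow> nat \<Rightarrow> sym" where
  "sec P q x = (if x div 4 < length P then local_sec (P ! (x div 4)) q (x mod 4) else One)"

text \<open>The action is on words over all naturals, so that products and inverses are those of
  total functions. The finite alphabet enters only when \<open>represents\<close> restricts
  them.\<close>

fun act :: "instr list \<Rightarrow> sym \<Rightarrow> nat list \<Rightarrow> nat list" where
  "act P q [] = []"
| "act P q (x # u) = out P q x # act P (sec P q x) u"

definition letter :: "nat \<Rightarrow> nat \<Rightarrow> nat" where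
  "letter j c = 4 * j + c"

lemma out_letter [simp]: "c < 4 \<Longrightarrow> out P q (letter j c) =
    (if j < length P then letter j (local_out (P ! j) j q c) else letter j c)"
  by (simp add: out_def letter_def)

lemma sec_letter [simp]: "c < 4 \<Longrightarrow> sec P q (letter j c) =
    (if j < length P then local_sec (P ! j) q c else One)"
  by (simp add: sec_def letter_def)

lemma letter_div [simp]: "c < 4 \<Longrightarrow> letter j c div 4 = j"
  by (simp add: letter_def)

lemma letter_inject [simp]: "letter j b = letter j c \<longleftrightarrow> b = c"
  by (simp add: letter_def)

lemma local_out_less: "c < 4 \<Longrightarrow> local_out a j q c < 4"
  by (cases "(a, j, q, c)" rule: local_out.cases) (auto simp: tr_def)

lemma local_out_local_out: "local_out a j q (local_out a j q c) = c"
  by (cases "(a, j, q, c)" rule: local_out.cases) (auto simp: tr_def)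

lemma letter_cases:
  obtains j c where "x = letter j c" "c < 4"
  using that[of "x div 4" "x mod 4"] by (simp add: letter_def)

lemma out_div [simp]: "out P q x div 4 = x div 4"
  by (rule letter_cases[of x]) (auto simp: local_out_less)

lemma out_out [simp]: "out P q (out P q x) = x"
  by (rule letter_cases[of x]) (auto simp: local_out_less local_out_local_out)

lemma act_One [simp]: "act P One u = u"
proof (induction u)
  case (Cons x u)
  have "local_out a j One c = c" "local_sec a One c = One" for a j c by (cases a; simp)+
  then have "out P One x = x" "sec P One x = One" by (auto simp: out_def sec_def)
  then show ?case using Cons by simp
qed simp

text \<open>For every symbol, \<open>T l\<close> included, the permutation of letters is an
  involution; bijectivity passes to words letter by letter.\<close>

lemma bij_act: "bij (act P q)"
proof (rule bijI)
  have "act P q u = act P q v \<Longrightarrow> u = v" for u v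
  proof (induction u arbitrary: q v)
    case (Cons x u)
    then obtain y w where v: "v = y # w" by (cases v) auto
    then have "x = y" using Cons.prems by (metis act.simps(2) list.inject out_out)
    then show ?case using Cons v by auto
  qed (metis act.elims list.distinct(1))
  then show "inj (act P q)" by (rule injI)
  have "\<exists>u. act P q u = v" for v
  proof (induction v arbitrary: q)
    case (Cons y v)
    obtain u where "act P (sec P q (out P q y)) u = v" using Cons by blast
    then show ?case by (intro exI[of _ "out P q y # u"]) simp
  qed (metis act.simps(1))
  then show "surj (act P q)" by (metis surjI)
qed

text \<open>The sections of \<open>One\<close>, \<open>A\<close> and \<open>B l\<close> agree on the
  two letters of each transposition and are again such symbols, so they cancel by induction.\<close>

lemma act_act: "(\<And>l. q \<noteq> T l) \<Longrightarrow> act P q (act P q u) = u"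
proof (induction u arbitrary: q)
  case (Cons x u)
  have "local_sec a q (local_out a j q c) = local_sec a q c" for a j c
    using Cons.prems by (cases a; cases q; auto simp: tr_def)
  moreover have "local_sec a q c \<noteq> T l" for a c l
    using Cons.prems by (cases a; cases q; auto)
  ultimately have "sec P q (out P q x) = sec P q x" "\<And>l. sec P q x \<noteq> T l"
    by (cases rule: letter_cases[of x]; simp add: local_out_less)+
  then show ?case using Cons.IH by simp
qed simp

section \<open>Configurations as automorphisms, and their sections at letters\<close>

definition tau :: "instr list \<Rightarrow> (nat \<Rightarrow> nat) \<Rightarrow> nat list \<Rightarrow> nat list \<Rightarrow> nat list" where
  "tau P m ls = foldr (\<lambda>l f. (act P (T l) ^^ (2 ^ m l)) \<circ> f) ls id"

lemma tau_Nil [simp]: "tau P m [] = id"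
  and tau_Cons [simp]: "tau P m (l # ls) = (act P (T l) ^^ (2 ^ m l)) \<circ> tau P m ls"
  by (simp_all add: tau_def)

lemma tau_append [simp]: "tau P m (ls @ ls') = tau P m ls \<circ> tau P m ls'"
  by (induction ls) (auto simp: o_assoc)

lemma tau_cong: "(\<And>l. l \<in> set ls \<Longrightarrow> m l = m' l) \<Longrightarrow> tau P m ls = tau P m' ls"
  by (induction ls) auto

lemma bij_tau: "bij (tau P m ls)"
  by (induction ls) (simp_all only: tau_Nil tau_Cons bij_id bij_comp bij_fn bij_act)

abbreviation fun_inv :: "('a \<Rightarrow> 'b) \<Rightarrow> 'b \<Rightarrow> 'a" where
  "fun_inv \<equiv> inv_into UNIV"

definition conf :: "instr list \<Rightarrow> nat \<Rightarrow> nat \<times> (nat \<Rightarrow> nat) \<Rightarrow> nat list \<Rightarrow> nat list" where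
  "conf P N c = fun_inv (tau P (snd c) [0..<N]) \<circ> act P (B (fst c)) \<circ> tau P (snd c) [0..<N] \<circ> act P A"

definition section_at :: "(nat list \<Rightarrow> nat list) \<Rightarrow> nat \<Rightarrow> nat \<Rightarrow> (nat list \<Rightarrow> nat list) \<Rightarrow> bool" where
  "section_at f x y h \<longleftrightarrow> (\<forall>u. f (x # u) = y # h u)"

lemma section_at_comp:
  "section_at f x y h \<Longrightarrow> section_at g y z k \<Longrightarrow> section_at (g \<circ> f) x z (k \<circ> h)"
  by (simp add: section_at_def)

lemma section_at_funpow: "section_at f x x h \<Longrightarrow> section_at (f ^^ n) x x (h ^^ n)"
  by (induction n) (auto simp: section_at_def)

lemma section_at_funpow_id: "section_at f x x id \<Longrightarrow> section_at (f ^^ n) x x id"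
  by (induction n) (auto simp: section_at_def)

lemma section_at_inv:
  assumes "section_at f x y h" "bij f" "bij h"
  shows "section_at (fun_inv f) y x (fun_inv h)"
  unfolding section_at_def
proof
  fix u
  have "f (x # fun_inv h u) = y # u"
    using assms by (simp add: section_at_def bij_is_surj surj_f_inv_f)
  then show "fun_inv f (y # u) = x # fun_inv h u" using assms(2) by (metis bij_inv_eq_iff)
qed

lemma section_at_act:
  assumes "out P q x = y" "act P (sec P q x) = h"
  shows "section_at (act P q) x y h"
  using assms by (auto simp: section_at_def)

lemma section_at_tau:
  assumes "\<And>l. l \<in> set ls \<Longrightarrow> section_at (act P (T l)) x x (if Q l then act P (T l) else id)"
  shows "section_at (tau P m ls) x x (tau P m (filter Q ls))"
  using assms
proof (induction ls)
  case (Cons l ls)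
  have IH: "section_at (tau P m ls) x x (tau P m (filter Q ls))" using Cons by simp
  have "section_at (act P (T l) ^^ n) x x (if Q l then act P (T l) ^^ n else id)" for n
    using Cons.prems[OF list.set_intros(1)] section_at_funpow section_at_funpow_id by metis
  from section_at_comp[OF IH this[of "2 ^ m l"]] show ?case
    by (cases "Q l") (simp_all only: tau_Cons filter.simps if_True if_False id_comp)
qed (simp add: section_at_def)

lemma section_at_tau_id:
  "(\<And>l. l \<in> set ls \<Longrightarrow> section_at (act P (T l)) x x id) \<Longrightarrow> section_at (tau P m ls) x x id"
  using section_at_tau[of ls P x "\<lambda>_. False" m] by simp

text \<open>The letter travels along \<open>x\<close>, \<open>x1\<close>, \<open>x2\<close>,
  \<open>x3\<close>, \<open>y\<close>. The last factor is an inverse, so its hypothesis is read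
  backwards, from \<open>y\<close> to \<open>x3\<close>.\<close>

lemma section_at_conf:
  assumes "section_at (act P A) x x1 a" "section_at (tau P (snd c) [0..<N]) x1 x2 t"
    "section_at (act P (B (fst c))) x2 x3 b" "section_at (tau P (snd c) [0..<N]) y x3 s" "bij s"
  shows "section_at (conf P N c) x y (fun_inv s \<circ> b \<circ> t \<circ> a)"
  using section_at_comp[OF section_at_comp[OF section_at_comp[OF assms(1,2)] assms(3)]
    section_at_inv[OF assms(4) bij_tau assms(5)]]
  by (simp add: conf_def comp_assoc)

lemma funpow_fix_orbit:
  assumes "section_at (g ^^ d) x x h" "h ^^ M = id"
  shows "(g ^^ (d * M)) (x # u) = x # u"
  using section_at_funpow[OF assms(1), of M] assms(2)
  by (simp add: section_at_def funpow_mult)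

text \<open>\<open>g\<close> commutes with its powers, so fixing all words below \<open>x\<close>
  carries over to their images. As \<open>h\<close> is surjective, these are all words below
  \<open>y\<close>.\<close>

lemma funpow_fix_image:
  assumes "\<And>u. (g ^^ K) (x # u) = x # u" "section_at g x y h" "bij h"
  shows "(g ^^ K) (y # u) = y # u"
proof -
  obtain v where v: "u = h v" using bij_is_surj[OF assms(3)] by (metis surjD)
  then have "y # u = g (x # v)" using assms(2) by (simp add: section_at_def)
  then show ?thesis using assms(1) by (simp add: funpow_swap1[symmetric])
qed

lemma funpow_fix_mult: "(g ^^ K) w = w \<Longrightarrow> (g ^^ (K * n)) w = w"
  by (induction n) (auto simp: funpow_add)

text \<open>The letter \<open>x\<close> returns to itself for the first time after \<open>d\<close>
  steps, so a power fixing the words below \<open>x\<close> has exponent divisible by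
  \<open>d\<close>. The set \<open>U\<close> is there because only words over the finite alphabet
  are known to be fixed; \<open>v\<close> supplies one such word.\<close>

lemma no_early_return:
  assumes "section_at (g ^^ d) x x h" "d > 0"
    and r: "\<And>r. 0 < r \<Longrightarrow> r < d \<Longrightarrow> \<exists>y k. y \<noteq> x \<and> section_at (g ^^ r) x y k"
    and M: "\<And>u. u \<in> U \<Longrightarrow> (g ^^ M) (x # u) = x # u" and "v \<in> U"
  obtains q where "M = d * q" "\<And>u. u \<in> U \<Longrightarrow> (h ^^ q) u = u"
proof -
  define q where "q = M div d"
  define r where "r = M mod d"
  have Mqr: "M = r + d * q" by (simp add: q_def r_def)
  have q: "section_at (g ^^ (d * q)) x x (h ^^ q)"
    using section_at_funpow[OF assms(1), of q] by (simp add: funpow_mult)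
  have "r = 0"
  proof (rule ccontr)
    assume "r \<noteq> 0"
    then obtain y k where y: "y \<noteq> x" "section_at (g ^^ r) x y k"
      using r[of r] \<open>d > 0\<close> by (auto simp: r_def)
    show False using M[OF \<open>v \<in> U\<close>] section_at_comp[OF q y(2)] y(1)
      by (simp add: section_at_def Mqr funpow_add)
  qed
  then show thesis using that[of q] Mqr M q by (simp add: section_at_def)
qed

section \<open>First return to the distinguished letter\<close>

lemma upt_split: "i < N \<Longrightarrow> [0..<N] = [0..<i] @ i # [Suc i..<N]"
  using upt_add_eq_append[of 0 i "N - i"] upt_conv_Cons[of i N] by simp

text \<open>The multiplier \<open>4\<close> in the last clause is a common multiple of both orbit lengths.\<close>

definition return :: "instr list \<Rightarrow> nat \<Rightarrow> nat \<times> (nat \<Rightarrow> nat) \<Rightarrow> nat \<Rightarrow> (nat list \<Rightarrow> nat list) \<Rightarrow> bool" where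
  "return P N c d g \<longleftrightarrow> section_at (conf P N c ^^ d) (letter (fst c) 0) (letter (fst c) 0) g \<and>
    (\<forall>r. 0 < r \<longrightarrow> r < d \<longrightarrow>
      (\<exists>y k. y \<noteq> letter (fst c) 0 \<and> section_at (conf P N c ^^ r) (letter (fst c) 0) y k)) \<and>
    (\<forall>M. g ^^ M = id \<longrightarrow>
      (\<forall>b<4. \<forall>u. (conf P N c ^^ (4 * M)) ((letter (fst c) b) # u) = (letter (fst c) b) # u))"

lemma less_4_cases: "(b :: nat) < 4 \<Longrightarrow> b = 0 \<or> b = 1 \<or> b = 2 \<or> b = 3"
  by auto

text \<open>The letters form one cycle \<open>0, 1, 3, 2\<close> with sections \<open>t2 A\<close>,
  \<open>t1\<close>, \<open>t1^-1 B_k\<close>, \<open>t2^-1\<close>. Their product is the conjugate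
  of \<open>B_k\<close> by \<open>t1 t2\<close>, followed on the right by \<open>A\<close>. As all
  four letters lie in this cycle, their sections are conjugate.\<close>

lemma return_Inc:
  assumes j: "j < length P" "P ! j = Inc i k" and i: "i < N"
  shows "return P N (j, m) 4 (conf P N (k, m(i := Suc (m i))))"
proof -
  let ?g = "conf P N (j, m)"
  let ?X = "\<lambda>b. letter j b"
  define t1 where "t1 = tau P m ([0..<i] @ [i])"
  define t2 where "t2 = tau P m (i # [Suc i..<N])"
  have bij: "bij t1" "bij t2" unfolding t1_def t2_def by (rule bij_tau)+
  have f: "filter (\<lambda>l. i \<le> l) [0..<N] = i # [Suc i..<N]" "filter (\<lambda>l. l \<le> i) [0..<N] = [0..<i] @ [i]"
    unfolding upt_split[OF i] by (auto simp: filter_empty_conv filter_id_conv)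
  have tau: "section_at (tau P m [0..<N]) (?X 0) (?X 0) t2" "section_at (tau P m [0..<N]) (?X 2) (?X 2) t1"
    "section_at (tau P m [0..<N]) (?X 1) (?X 1) id" "section_at (tau P m [0..<N]) (?X 3) (?X 3) id"
    unfolding t1_def t2_def f[symmetric]
    by (auto intro!: section_at_tau section_at_tau_id section_at_act simp: j fun_eq_iff simp del: One_nat_def)
  have a: "section_at (act P A) (?X 0) (?X 0) (act P A)" "section_at (act P A) (?X 1) (?X 2) id"
    "section_at (act P A) (?X 2) (?X 1) id" "section_at (act P A) (?X 3) (?X 3) (act P (B k))"
    by (auto intro!: section_at_act simp: j fun_eq_iff tr_def simp del: One_nat_def)
  have b: "section_at (act P (B j)) (?X 0) (?X 1) id" "section_at (act P (B j)) (?X 1) (?X 0) id"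
    "section_at (act P (B j)) (?X 2) (?X 3) id" "section_at (act P (B j)) (?X 3) (?X 2) id"
    by (auto intro!: section_at_act simp: j fun_eq_iff tr_def simp del: One_nat_def)
  note conf = section_at_conf[where c = "(j, m)", unfolded fst_conv snd_conv]
  have g0: "section_at ?g (?X 0) (?X 1) (t2 \<circ> act P A)"
    using conf[OF a(1) tau(1) b(1) tau(3)] by simp
  have g1: "section_at ?g (?X 1) (?X 3) t1"
    using conf[OF a(2) tau(2) b(3) tau(4)] by simp
  have g3: "section_at ?g (?X 3) (?X 2) (fun_inv t1 \<circ> act P (B k))"
    using conf[OF a(4) tau(4) b(4) tau(2)] bij by simp
  have g2: "section_at ?g (?X 2) (?X 0) (fun_inv t2)"
    using conf[OF a(3) tau(3) b(2) tau(1)] bij by simp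
  have p2: "section_at (?g ^^ 2) (?X 0) (?X 3) (t1 \<circ> (t2 \<circ> act P A))"
    using section_at_comp[OF g0 g1] by (simp add: numeral_2_eq_2)
  have p3: "section_at (?g ^^ 3) (?X 0) (?X 2) (fun_inv t1 \<circ> act P (B k) \<circ> (t1 \<circ> (t2 \<circ> act P A)))"
    using section_at_comp[OF p2 g3] by (simp add: numeral_eq_Suc)
  \<comment> \<open>\<open>t1\<close> ends and \<open>t2\<close> begins with the power of
    \<open>t_i\<close>; at the seam the exponents add up to
    \<open>2 ^ m i + 2 ^ m i\<close>.\<close>
  have t: "t1 \<circ> t2 = tau P (m(i := Suc (m i))) [0..<N]"
  proof -
    have "tau P (m(i := Suc (m i))) [0..<i] = tau P m [0..<i]"
      "tau P (m(i := Suc (m i))) [Suc i..<N] = tau P m [Suc i..<N]"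
      by (rule tau_cong; simp)+
    then show ?thesis unfolding upt_split[OF i] t1_def t2_def
      by (simp add: comp_assoc mult_2 funpow_add)
  qed
  have "fun_inv t2 \<circ> (fun_inv t1 \<circ> act P (B k) \<circ> (t1 \<circ> (t2 \<circ> act P A))) = conf P N (k, m(i := Suc (m i)))"
    unfolding conf_def fst_conv snd_conv t[symmetric] o_inv_distrib[OF bij] by (simp add: comp_assoc)
  with section_at_comp[OF p3 g2]
  have p4: "section_at (?g ^^ 4) (?X 0) (?X 0) (conf P N (k, m(i := Suc (m i))))"
    by (simp add: numeral_eq_Suc)
  have early: "\<exists>y k. y \<noteq> letter j 0 \<and> section_at (?g ^^ r) (letter j 0) y k" if "0 < r" "r < 4" for r
  proof -
    have "r = 1 \<or> r = 2 \<or> r = 3" using that by auto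
    then show ?thesis
    proof (elim disjE)
      assume "r = 1"
      then show ?thesis using g0 by (intro exI[of _ "?X 1"]) auto
    next
      assume "r = 2"
      then show ?thesis using p2 by (intro exI[of _ "?X 3"]) auto
    next
      assume "r = 3"
      then show ?thesis using p3 by (intro exI[of _ "?X 2"]) auto
    qed
  qed
  have "(?g ^^ (4 * M)) (?X b # u) = ?X b # u"
    if M: "conf P N (k, m(i := Suc (m i))) ^^ M = id" and "b < 4" for M b u
  proof -
    have F0: "(?g ^^ (4 * M)) (?X 0 # u) = ?X 0 # u" for u by (rule funpow_fix_orbit[OF p4 M])
    have F1: "(?g ^^ (4 * M)) (?X 1 # u) = ?X 1 # u" for u
      by (rule funpow_fix_image[OF F0 g0]) (intro bij_comp bij bij_act)
    have F3: "(?g ^^ (4 * M)) (?X 3 # u) = ?X 3 # u" for u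
      by (rule funpow_fix_image[OF F1 g1 bij(1)])
    have F2: "(?g ^^ (4 * M)) (?X 2 # u) = ?X 2 # u" for u
      by (rule funpow_fix_image[OF F3 g3]) (intro bij_comp bij_imp_bij_inv bij bij_act)
    show ?thesis using less_4_cases[OF \<open>b < 4\<close>] F0 F1 F2 F3 by blast
  qed
  then show ?thesis using p4 early unfolding return_def by auto
qed

text \<open>The pattern of a decrement: the letters form two cycles of length two. The cycle through
  letter \<open>0\<close> carries the next configuration, the other a square with section of order
  at most two.\<close>

lemma return_two_cycles:
  assumes g: "section_at (conf P N c) (letter (fst c) 0) y h" "section_at (conf P N c) y (letter (fst c) 0) h'"
    "h' \<circ> h = g" "bij h"
    and k: "section_at (conf P N c) x' y' k" "section_at (conf P N c) y' x' k'"
    "(k' \<circ> k) \<circ> (k' \<circ> k) = id" "bij k"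
    and letters: "\<And>b. b < 4 \<Longrightarrow> letter (fst c) b \<in> {letter (fst c) 0, y, x', y'}" and "y \<noteq> letter (fst c) 0"
  shows "return P N c 2 g"
proof -
  let ?g = "conf P N c"
  have p: "section_at (?g ^^ 2) (letter (fst c) 0) (letter (fst c) 0) g"
    using section_at_comp[OF g(1,2)] g(3) by (simp add: numeral_2_eq_2)
  \<comment> \<open>The section of the square is an involution or trivial, so the fourth power is
    trivial below \<open>x'\<close>.\<close>
  have "section_at (?g ^^ 2) x' x' (k' \<circ> k)"
    using section_at_comp[OF k(1,2)] by (simp add: numeral_2_eq_2)
  from section_at_funpow[OF this, of 2] k(3) have q: "section_at (?g ^^ 4) x' x' id"
    by (simp add: numeral_2_eq_2 funpow_mult) (simp add: numeral_eq_Suc comp_assoc)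
  have "(?g ^^ (4 * M)) ((letter (fst c) b) # u) = (letter (fst c) b) # u"
    if M: "g ^^ M = id" and "b < 4" for M b u
  proof -
    have "(?g ^^ (2 * M)) (letter (fst c) 0 # u) = letter (fst c) 0 # u" for u by (rule funpow_fix_orbit[OF p M])
    then have F0: "(?g ^^ (4 * M)) (letter (fst c) 0 # u) = letter (fst c) 0 # u" for u
      using funpow_fix_mult[of "2 * M" ?g _ 2] by (simp add: mult.commute mult.left_commute)
    have F1: "(?g ^^ (4 * M)) (y # u) = y # u" for u
      by (rule funpow_fix_image[OF F0 g(1,4)])
    have F2: "(?g ^^ (4 * M)) (x' # u) = x' # u" for u
      by (rule funpow_fix_orbit[OF q]) simp
    have F3: "(?g ^^ (4 * M)) (y' # u) = y' # u" for u
      by (rule funpow_fix_image[OF F2 k(1,4)])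
    show ?thesis using letters[OF \<open>b < 4\<close>] F0 F1 F2 F3 by auto
  qed
  moreover have "\<exists>y k. y \<noteq> letter (fst c) 0 \<and> section_at (?g ^^ r) (letter (fst c) 0) y k" if "0 < r" "r < 2" for r
  proof -
    have "r = 1" using that by simp
    then show ?thesis using g(1) \<open>y \<noteq> letter (fst c) 0\<close> by auto
  qed
  ultimately show ?thesis using p unfolding return_def by auto
qed

text \<open>At letters \<open>0\<close> and \<open>1\<close> every \<open>t_l\<close> with
  \<open>l \<noteq> i\<close> fixes the letter and has itself as section. Hence \<open>t_i\<close>
  alone decides where the letter goes.\<close>

lemma section_at_tau_Dec:
  assumes j: "j < length P" "P ! j = Dec i k k'" and i: "i < N"
    and b: "b < 2" "b' < 2"
    and s: "section_at (act P (T i) ^^ (2 ^ m i)) (letter j b) (letter j b') h"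
  shows "section_at (tau P m [0..<N]) (letter j b) (letter j b') (tau P m [0..<i] \<circ> h \<circ> tau P m [Suc i..<N])"
proof -
  have rest: "section_at (tau P m ls) (letter j b) (letter j b) (tau P m ls)" if "i \<notin> set ls" "b < 2" for ls b
  proof -
    have "section_at (tau P m ls) (letter j b) (letter j b) (tau P m (filter (\<lambda>_. True) ls))"
      using that by (intro section_at_tau section_at_act) (auto simp: j less_2_cases_iff)
    then show ?thesis by simp
  qed
  have "section_at (tau P m [0..<i] \<circ> ((act P (T i) ^^ (2 ^ m i)) \<circ> tau P m [Suc i..<N]))
      (letter j b) (letter j b') (tau P m [0..<i] \<circ> (h \<circ> tau P m [Suc i..<N]))"
    using b by (intro section_at_comp[OF section_at_comp[OF rest s] rest]) auto
  then show ?thesis unfolding upt_split[OF i] by (simp add: comp_assoc)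
qed

lemma involution_conj:
  assumes "bij t" "b \<circ> b = id"
  shows "(fun_inv t \<circ> b \<circ> t) \<circ> (fun_inv t \<circ> b \<circ> t) = id"
  using assms by (auto simp: fun_eq_iff bij_is_surj surj_f_inv_f bij_is_inj)

lemma return_Dec:
  assumes j: "j < length P" "P ! j = Dec i k k'" and i: "i < N"
  shows "return P N (j, m) 2 (conf P N (exec (Dec i k k') m))"
proof -
  let ?g = "conf P N (j, m)"
  let ?X = "\<lambda>b. letter j b"
  have off: "section_at (tau P m [0..<N]) (?X 2) (?X 2) id" "section_at (tau P m [0..<N]) (?X 3) (?X 3) id"
    by (auto intro!: section_at_tau_id section_at_act simp: j fun_eq_iff tr_def simp del: One_nat_def)
  have a: "section_at (act P A) (?X 0) (?X 0) (act P A)" "section_at (act P A) (?X 1) (?X 1) id"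
    "section_at (act P A) (?X 2) (?X 2) (act P (B k))" "section_at (act P A) (?X 3) (?X 3) (act P (B k'))"
    by (auto intro!: section_at_act simp: j fun_eq_iff tr_def simp del: One_nat_def)
  have b: "section_at (act P (B j)) (?X 0) (?X 2) id" "section_at (act P (B j)) (?X 2) (?X 0) id"
    "section_at (act P (B j)) (?X 1) (?X 3) id" "section_at (act P (B j)) (?X 3) (?X 1) id"
    by (auto intro!: section_at_act simp: j fun_eq_iff tr_def simp del: One_nat_def)
  have t: "section_at (act P (T i)) (?X 0) (?X 1) (act P (T i))" "section_at (act P (T i)) (?X 1) (?X 0) id"
    by (auto intro!: section_at_act simp: j fun_eq_iff tr_def simp del: One_nat_def)
  have BB: "act P (B l) \<circ> act P (B l) = id" for l
    by (auto simp: fun_eq_iff intro!: act_act)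
  note conf = section_at_conf[where c = "(j, m)", unfolded fst_conv snd_conv]
  note tau = section_at_tau_Dec[OF j i]
  show ?thesis
  proof (cases "m i")
    case 0
    \<comment> \<open>An empty register means exponent \<open>1\<close>: \<open>tau\<close> swaps
      letters \<open>0\<close> and \<open>1\<close>, with itself as section at \<open>0\<close> and
      with \<open>\<rho>\<close>, where \<open>t_i\<close> is missing, at \<open>1\<close>. The path
      from \<open>0\<close> therefore runs through letter \<open>3\<close> and picks up
      \<open>B k'\<close>.\<close>
    define \<rho> where "\<rho> = tau P m [0..<i] \<circ> id \<circ> tau P m [Suc i..<N]"
    let ?\<tau> = "tau P m [0..<N]"
    have bij: "bij \<rho>" "bij ?\<tau>" unfolding \<rho>_def by (auto intro!: bij_comp bij_tau)
    have s0: "section_at ?\<tau> (?X 0) (?X 1) ?\<tau>"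
      using tau[of 0 1 m "act P (T i)"] t(1) 0 by (simp add: upt_split[OF i] comp_assoc)
    have s1: "section_at ?\<tau> (?X 1) (?X 0) \<rho>"
      using tau[of 1 0 m id] t(2) 0 by (simp add: \<rho>_def)
    have g0: "section_at ?g (?X 0) (?X 3) (?\<tau> \<circ> act P A)"
      using conf[OF a(1) s0 b(3) off(2)] by simp
    have g3: "section_at ?g (?X 3) (?X 0) (fun_inv ?\<tau> \<circ> act P (B k'))"
      using conf[OF a(4) off(2) b(4) s0] bij by simp
    have g1: "section_at ?g (?X 1) (?X 2) \<rho>"
      using conf[OF a(2) s1 b(1) off(1)] by simp
    have g2: "section_at ?g (?X 2) (?X 1) (fun_inv \<rho> \<circ> act P (B k))"
      using conf[OF a(3) off(1) b(2) s1] bij by simp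
    show ?thesis
    proof (rule return_two_cycles[of P N "(j, m)", unfolded fst_conv])
      show "section_at ?g (letter j 0) (?X 3) (?\<tau> \<circ> act P A)"
        "section_at ?g (?X 3) (letter j 0) (fun_inv ?\<tau> \<circ> act P (B k'))" using g0 g3 by simp_all
      show "fun_inv ?\<tau> \<circ> act P (B k') \<circ> (?\<tau> \<circ> act P A) = conf P N (exec (Dec i k k') m)"
        using 0 by (simp add: conf_def comp_assoc)
      show "fun_inv \<rho> \<circ> act P (B k) \<circ> \<rho> \<circ> (fun_inv \<rho> \<circ> act P (B k) \<circ> \<rho>) = id"
        by (rule involution_conj[OF bij(1) BB])
      show "bij (?\<tau> \<circ> act P A)" "bij \<rho>" by (intro bij_comp bij bij_act)+
      show "section_at ?g (?X 1) (?X 2) \<rho>" "section_at ?g (?X 2) (?X 1) (fun_inv \<rho> \<circ> act P (B k))"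
        by (fact g1 g2)+
      show "?X b \<in> {letter j 0, ?X 3, ?X 1, ?X 2}" if "b < 4" for b
        using less_4_cases[OF that] by auto
    qed simp
  next
    case (Suc n)
    \<comment> \<open>An even exponent fixes letters \<open>0\<close> and \<open>1\<close>, with
      \<open>t'\<close> as section at both. The path from \<open>0\<close> runs through letter
      \<open>2\<close> and picks up \<open>B k\<close>.\<close>
    define t' where "t' = tau P m [0..<i] \<circ> (act P (T i) ^^ (2 ^ n)) \<circ> tau P m [Suc i..<N]"
    have bij: "bij t'" unfolding t'_def by (intro bij_comp bij_tau bij_fn bij_act)
    have "tau P (m(i := n)) [0..<i] = tau P m [0..<i]"
      "tau P (m(i := n)) [Suc i..<N] = tau P m [Suc i..<N]"
      by (rule tau_cong; simp)+
    then have t': "t' = tau P (m(i := n)) [0..<N]"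
      unfolding upt_split[OF i] t'_def by (simp add: comp_assoc)
    \<comment> \<open>This is the odometer: the square of \<open>t_i\<close> has the section
      \<open>t_i\<close> at both letters, so the exponent is halved.\<close>
    have "section_at (act P (T i) ^^ 2) (?X 0) (?X 0) (act P (T i))"
      "section_at (act P (T i) ^^ 2) (?X 1) (?X 1) (act P (T i))"
      using section_at_comp[OF t(1,2)] section_at_comp[OF t(2,1)] by (simp_all add: numeral_2_eq_2)
    from this[THEN section_at_funpow, of "2 ^ n"]
    have "section_at (act P (T i) ^^ (2 ^ m i)) (?X 0) (?X 0) (act P (T i) ^^ (2 ^ n))"
      "section_at (act P (T i) ^^ (2 ^ m i)) (?X 1) (?X 1) (act P (T i) ^^ (2 ^ n))"
      by (simp_all add: funpow_mult Suc)
    with tau[of 0 0 m "act P (T i) ^^ (2 ^ n)"] tau[of 1 1 m "act P (T i) ^^ (2 ^ n)"]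
    have s: "section_at (tau P m [0..<N]) (?X 0) (?X 0) t'"
      "section_at (tau P m [0..<N]) (?X 1) (?X 1) t'"
      by (simp_all add: t'_def)
    have g0: "section_at ?g (?X 0) (?X 2) (t' \<circ> act P A)"
      using conf[OF a(1) s(1) b(1) off(1)] by simp
    have g2: "section_at ?g (?X 2) (?X 0) (fun_inv t' \<circ> act P (B k))"
      using conf[OF a(3) off(1) b(2) s(1)] bij by simp
    have g1: "section_at ?g (?X 1) (?X 3) t'"
      using conf[OF a(2) s(2) b(3) off(2)] by simp
    have g3: "section_at ?g (?X 3) (?X 1) (fun_inv t' \<circ> act P (B k'))"
      using conf[OF a(4) off(2) b(4) s(2)] bij by simp
    show ?thesis
    proof (rule return_two_cycles[of P N "(j, m)", unfolded fst_conv])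
      show "section_at ?g (letter j 0) (?X 2) (t' \<circ> act P A)"
        "section_at ?g (?X 2) (letter j 0) (fun_inv t' \<circ> act P (B k))" using g0 g2 by simp_all
      show "fun_inv t' \<circ> act P (B k) \<circ> (t' \<circ> act P A) = conf P N (exec (Dec i k k') m)"
        using Suc by (simp add: conf_def comp_assoc t')
      show "fun_inv t' \<circ> act P (B k') \<circ> t' \<circ> (fun_inv t' \<circ> act P (B k') \<circ> t') = id"
        by (rule involution_conj[OF bij BB])
      show "bij (t' \<circ> act P A)" "bij t'" by (intro bij_comp bij bij_act)+
      show "section_at ?g (?X 1) (?X 3) t'" "section_at ?g (?X 3) (?X 1) (fun_inv t' \<circ> act P (B k'))"
        by (fact g1 g3)+
      show "?X b \<in> {letter j 0, ?X 2, ?X 1, ?X 3}" if "b < 4" for b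
        using less_4_cases[OF that] by auto
    qed simp
  qed
qed

lemma return_step:
  assumes "fst c < length P" "bounded_instr N (P ! fst c)"
  shows "\<exists>d\<in>{2, 4}. return P N c d (conf P N (minsky_step P c))"
proof (cases "P ! fst c")
  case (Inc i k)
  then show ?thesis using assms return_Inc[of "fst c" P i k N "snd c"] by (simp add: minsky_step_def)
next
  case (Dec i k k')
  then show ?thesis using assms return_Dec[of "fst c" P i k k' N "snd c"]
    by (simp add: minsky_step_def del: exec.simps)
qed

section \<open>Halting and the order of a configuration\<close>

lemma halts_step: "halts P (minsky_step P c) \<Longrightarrow> halts P c"
  unfolding halts_def by (metis funpow_simps_right(2) comp_apply)

text \<open>On such words \<open>B j\<close> is trivial, so \<open>tau\<close> cancels against its
  inverse and the configuration acts as the involution \<open>A\<close>. The empty word is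
  included.\<close>

definition away :: "nat \<Rightarrow> nat list \<Rightarrow> bool" where
  "away j w \<longleftrightarrow> (\<forall>x u. w = x # u \<longrightarrow> x div 4 \<noteq> j)"

lemma away_act: "away j w \<Longrightarrow> away j (act P q w)"
  by (cases w) (auto simp: away_def)

lemma away_tau: "away j w \<Longrightarrow> away j (tau P m ls w)"
proof (induction ls)
  case (Cons l ls)
  have "away j v \<Longrightarrow> away j ((act P (T l) ^^ n) v)" for n v
    by (induction n) (auto intro: away_act)
  then show ?case using Cons by simp
qed simp

lemma act_B_away: "away j w \<Longrightarrow> act P (B j) w = w"
proof (cases w)
  case (Cons x u)
  assume "away j w"
  then have "x div 4 \<noteq> j" using Cons by (auto simp: away_def)
  then have "local_out a (x div 4) (B j) b = b" "local_sec a (B j) b = One" for a b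
    by (cases a; auto)+
  then show ?thesis using Cons by (simp add: out_def sec_def)
qed simp

lemma conf_away: "away (fst c) w \<Longrightarrow> conf P N c w = act P A w"
  unfolding conf_def by (simp add: act_B_away away_tau away_act bij_is_inj[OF bij_tau])

lemma conf_away_even: "away (fst c) w \<Longrightarrow> (conf P N c ^^ (2 * n)) w = w"
  by (induction n) (auto simp: conf_away away_act act_act)

lemma conf_halted: "length P \<le> fst c \<Longrightarrow> conf P N c ^^ 2 = id"
proof -
  assume "length P \<le> fst c"
  then have "local_out (P ! j) j (B (fst c)) b = b" if "j < length P" for j b
    using that by (cases "P ! j") auto
  moreover have "local_sec a (B i) b = One" for a i b by (cases a) auto
  ultimately have "out P (B (fst c)) x = x" "sec P (B (fst c)) x = One" for x
    by (auto simp: out_def sec_def)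
  then have "act P (B (fst c)) w = w" for w by (cases w) auto
  then show ?thesis
    unfolding conf_def by (auto simp: fun_eq_iff numeral_2_eq_2 bij_is_inj[OF bij_tau] act_act)
qed

context
  fixes P :: "instr list" and N :: nat
  assumes bounded: "\<forall>a\<in>set P. bounded_instr N a"
begin

text \<open>Going back one machine step multiplies a trivial exponent by \<open>4\<close>: words
  outside the current block have period at most two, and the others are covered by
  \<open>return\<close>.\<close>

lemma conf_finite_order: "halts P c \<Longrightarrow> \<exists>n. conf P N c ^^ (2 ^ n) = id"
proof -
  assume "halts P c"
  then obtain k where "length P \<le> fst ((minsky_step P ^^ k) c)" by (auto simp: halts_def)
  then show ?thesis
  proof (induction k arbitrary: c)
    case 0
    then show ?case using conf_halted by (intro exI[of _ 1]) simp
  next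
    case (Suc k)
    show ?case
    proof (cases "fst c < length P")
      case False
      then show ?thesis using conf_halted by (intro exI[of _ 1]) simp
    next
      case True
      obtain n where n: "conf P N (minsky_step P c) ^^ (2 ^ n) = id"
        using Suc.IH[of "minsky_step P c"] Suc.prems
        unfolding funpow_Suc_right comp_apply by blast
      obtain d where d: "return P N c d (conf P N (minsky_step P c))"
        using return_step[OF True, of N] bounded True by auto
      have "(conf P N c ^^ (4 * 2 ^ n)) w = w" for w
      proof (cases "away (fst c) w")
        case True
        then show ?thesis using conf_away_even[where n = "2 * 2 ^ n"] by simp
      next
        case False
        then obtain x u where w: "w = x # u" "x div 4 = fst c" by (auto simp: away_def)
        obtain b where "b < 4" "x = letter (fst c) b"
          using w(2) letter_cases[of x] by (metis letter_div)
        then show ?thesis using d n w(1) unfolding return_def by blast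
      qed
      then have "conf P N c ^^ (2 ^ (n + 2)) = id" by (auto simp: fun_eq_iff)
      then show ?thesis by blast
    qed
  qed
qed

text \<open>Descent on the exponent: a positive \<open>M\<close> that trivialises the configuration
  equals \<open>d * q\<close>, and \<open>q\<close> trivialises the next one. Since \<open>d\<close>
  is at least \<open>2\<close>, this can go on only if the machine leaves the program
  eventually.\<close>

lemma conf_infinite_order:
  assumes "M > 0" "\<forall>u\<in>lists {..<4 * length P}. (conf P N c ^^ M) u = u"
  shows "halts P c"
  using assms
proof (induction M arbitrary: c rule: less_induct)
  case (less M)
  show ?case
  proof (cases "fst c < length P")
    case False
    then show ?thesis by (auto simp: halts_def intro!: exI[of _ 0])
  next
    case True
    obtain d where d: "d = 2 \<or> d = 4" "return P N c d (conf P N (minsky_step P c))"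
      using return_step[OF True, of N] bounded True by auto
    have "letter (fst c) 0 # u \<in> lists {..<4 * length P}" if "u \<in> lists {..<4 * length P}" for u
      using True that by (auto simp: letter_def)
    then have fixed: "(conf P N c ^^ M) (letter (fst c) 0 # u) = letter (fst c) 0 # u"
      if "u \<in> lists {..<4 * length P}" for u
      using less.prems(2) that by blast
    have sec: "section_at (conf P N c ^^ d) (letter (fst c) 0) (letter (fst c) 0)
        (conf P N (minsky_step P c))"
      and early: "\<And>r. 0 < r \<Longrightarrow> r < d \<Longrightarrow> \<exists>y k. y \<noteq> letter (fst c) 0 \<and>
        section_at (conf P N c ^^ r) (letter (fst c) 0) y k"
      using d(2) unfolding return_def by blast+
    have "d > 0" using d(1) by auto
    obtain q where q: "M = d * q"
      "\<And>u. u \<in> lists {..<4 * length P} \<Longrightarrow> (conf P N (minsky_step P c) ^^ q) u = u"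
      using no_early_return[OF sec \<open>d > 0\<close> early fixed lists.Nil] by blast
    have "q < M" "q > 0" using q(1) d(1) less.prems(1) by auto
    then have "halts P (minsky_step P c)" using less.IH q(2) by blast
    then show ?thesis by (rule halts_step)
  qed
qed

end

section \<open>The automaton group\<close>

definition prepend :: "('s \<Rightarrow> nat) \<Rightarrow> 's list \<Rightarrow> nat \<Rightarrow> nat" where
  "prepend e w r = foldr (\<lambda>x r. Suc (prod_encode (e x, r))) w r"

lemma word_code_append: "word_code e (v @ w) = prepend e v (word_code e w)"
  by (induction v) (auto simp: word_code_def prepend_def)

lemma prepend_concat_replicate:
  "prepend e (concat (replicate k v)) r = rec_nat r (\<lambda>_ r. prepend e v r) k"
  by (induction k) (auto simp: prepend_def)

lemma computable_prepend: "computable k F \<Longrightarrow> computable k (\<lambda>xs. prepend e w (F xs))"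
  unfolding prepend_def
  by (induction w) (simp_all add: computable_Suc computable_const computable_prod_encode)

text \<open>The words have length exponential in the input, yet a primitive recursion that prepends
  a fixed word \<open>2 ^ n\<close> times produces their codes. This is the shape of the words for
  the configurations \<open>input n\<close>.\<close>

lemma computable_word_code:
  "computable 1 (\<lambda>xs. word_code e
    (v1 @ concat (replicate (2 ^ (xs ! 0)) v2) @ v3 @ concat (replicate (2 ^ (xs ! 0)) v4) @ v5))"
proof -
  have rec: "computable k (\<lambda>xs. rec_nat (F xs) (\<lambda>_ r. prepend e v r) (N xs))"
    if "computable k F" "computable k N" for k F N v
    by (intro computable_rec_nat computable_prepend computable_nth that) simp
  have "computable 1 (\<lambda>xs. prepend e v1 (rec_nat (prepend e v3
      (rec_nat (word_code e v5) (\<lambda>_ r. prepend e v4 r) (2 ^ (xs ! 0)))) (\<lambda>_ r. prepend e v2 r) (2 ^ (xs ! 0))))"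
    by (intro rec computable_prepend computable_power computable_nth computable_const) simp_all
  then show ?thesis by (simp add: word_code_append prepend_concat_replicate)
qed

lemma inj_on_word_code: "inj_on e S \<Longrightarrow> inj_on (word_code e) (lists S)"
proof (rule inj_onI)
  fix v w assume e: "inj_on e S" and vw: "v \<in> lists S" "w \<in> lists S" "word_code e v = word_code e w"
  then have "map e v = map e w" by (metis word_code_def list_encode_inverse)
  moreover have "inj_on e (set v \<union> set w)"
    by (rule inj_on_subset[OF e]) (use vw in auto)
  ultimately show "v = w" by (rule map_inj_on)
qed

section \<open>Words and iterated commutators in a group\<close>

context group
begin

lemma word_value_closed: "w \<in> lists (carrier G) \<Longrightarrow> word_value G w \<in> carrier G"
  by (induction w) (auto simp: word_value_def)

lemma word_value_append:
  "v \<in> lists (carrier G) \<Longrightarrow> w \<in> lists (carrier G) \<Longrightarrow>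
    word_value G (v @ w) = word_value G v \<otimes> word_value G w"
proof (induction v)
  case (Cons x v)
  have "word_value G (x # u) = x \<otimes> word_value G u" for u by (simp add: word_value_def)
  then show ?case using Cons word_value_closed by (simp add: m_assoc)
qed (simp add: word_value_def word_value_closed[unfolded word_value_def])

lemma word_value_concat_replicate:
  "w \<in> lists (carrier G) \<Longrightarrow> word_value G (concat (replicate k w)) = word_value G w [^] k"
proof (induction k)
  case (Suc k)
  then have "concat (replicate k w) \<in> lists (carrier G)" by auto
  then show ?case
    using Suc word_value_closed[of w] nat_pow_Suc2[of "word_value G w" k]
    by (simp add: word_value_append)
qed (simp add: word_value_def)

lemma ex_word:
  assumes "symmetric_generating_set G S" "x \<in> carrier G"
  shows "\<exists>w\<in>lists S. word_value G w = x"
proof -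
  have S: "S \<subseteq> carrier G" "\<And>s. s \<in> S \<Longrightarrow> inv s \<in> S" and "x \<in> generate G S"
    using assms by (auto simp: symmetric_generating_set_def)
  then have sub: "lists S \<subseteq> lists (carrier G)" by auto
  from \<open>x \<in> generate G S\<close> show ?thesis
  proof induction
    case one
    show ?case by (intro bexI[of _ "[]"]) (auto simp: word_value_def)
  next
    case (incl h)
    then show ?case using S by (intro bexI[of _ "[h]"]) (auto simp: word_value_def)
  next
    case (inv h)
    then show ?case using S by (intro bexI[of _ "[inv h]"]) (auto simp: word_value_def)
  next
    case (eng h1 h2)
    then obtain v w where "v \<in> lists S" "word_value G v = h1" "w \<in> lists S" "word_value G w = h2"
      by blast
    moreover from this have "v \<in> lists (carrier G)" "w \<in> lists (carrier G)" using sub by blast+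
    ultimately show ?case by (intro bexI[of _ "v @ w"]) (auto simp: word_value_append)
  qed
qed

text \<open>If \<open>a\<close> inverts \<open>h\<close>, then the commutator of \<open>h\<close>
  and \<open>a\<close> is \<open>h^-2\<close>, which \<open>a\<close> inverts again. Allowing the
  power or its inverse spares keeping track of the alternating sign.\<close>

lemma iterated_commutator_inverted:
  assumes g: "g \<in> carrier G" and a: "a \<in> carrier G" and ga: "inv a \<otimes> g \<otimes> a = inv g"
  shows "iterated_commutator G n g a \<in> {g [^] ((2::nat) ^ n), inv (g [^] ((2::nat) ^ n))}"
proof -
  let ?x = "\<lambda>n. iterated_commutator G n g a"
  have "?x n \<in> carrier G \<and> inv a \<otimes> ?x n \<otimes> a = inv (?x n) \<and>
    ?x n \<in> {g [^] ((2::nat) ^ n), inv (g [^] ((2::nat) ^ n))}"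
  proof (induction n)
    case (Suc n)
    let ?h = "?x n"
    have h: "?h \<in> carrier G" "inv a \<otimes> ?h \<otimes> a = inv ?h" using Suc by auto
    have "inv (inv a \<otimes> ?h \<otimes> a) = inv a \<otimes> inv ?h \<otimes> a"
      using h(1) a by (simp add: inv_mult_group m_assoc)
    then have h': "inv a \<otimes> inv ?h \<otimes> a = ?h" unfolding h(2) using h(1) by simp
    have x: "?x (Suc n) = inv ?h \<otimes> inv ?h"
    proof -
      have "?x (Suc n) = inv ?h \<otimes> (inv a \<otimes> ?h \<otimes> a)"
        using h(1) a by (simp add: commutator_def m_assoc)
      then show ?thesis using h(2) by simp
    qed
    have "inv a \<otimes> (inv ?h \<otimes> inv ?h) \<otimes> a = (inv a \<otimes> inv ?h \<otimes> a) \<otimes> (inv a \<otimes> inv ?h \<otimes> a)"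
    proof -
      have "a \<otimes> (inv a \<otimes> z) = z" if "z \<in> carrier G" for z
        using a that by (simp add: m_assoc[symmetric])
      then show ?thesis using h(1) a by (simp add: m_assoc)
    qed
    also have "\<dots> = inv (?x (Suc n))" unfolding h' x using h(1) by (simp add: inv_mult_group)
    finally have "inv a \<otimes> ?x (Suc n) \<otimes> a = inv (?x (Suc n))" unfolding x .
    moreover have "?x (Suc n) \<in> carrier G" using x h(1) by simp
    moreover have "g [^] ((2::nat) ^ Suc n) = g [^] ((2::nat) ^ n) \<otimes> g [^] ((2::nat) ^ n)"
      using g by (simp add: nat_pow_mult mult_2)
    then have "?x (Suc n) \<in> {g [^] ((2::nat) ^ Suc n), inv (g [^] ((2::nat) ^ Suc n))}"
      unfolding x using Suc.IH g by (auto simp: inv_mult_group)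
    ultimately show ?case by blast
  qed (use g ga in auto)
  then show ?thesis by blast
qed

end

section \<open>The automaton of a machine\<close>

instance sym :: countable
  by countable_datatype

locale machine_automaton =
  fixes P :: "instr list" and N :: nat
  assumes bounded: "\<forall>a\<in>set P. bounded_instr N a" and length_le: "length P \<le> N" and N_pos: "0 < N"
begin

definition syms :: "sym set" where
  "syms = {One, A} \<union> T ` {..<N} \<union> B ` {..<N}"

definition mealy :: "(nat, nat) mealy" where
  "mealy = \<lparr>states = to_nat ` syms, alphabet = {..<4 * length P},
    step = (\<lambda>(p, x). to_nat (sec P (from_nat p) x)), outp = (\<lambda>(p, x). out P (from_nat p) x)\<rparr>"

abbreviation X :: "nat list set" where "X \<equiv> lists {..<4 * length P}"

abbreviation \<Gamma> :: "(nat list \<Rightarrow> nat list) monoid" where "\<Gamma> \<equiv> mealy_group mealy"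

text \<open>The only new indices in sections are the jump targets in \<open>B k\<close>; the bound
  on the instructions keeps them below \<open>N\<close>, so the state set is closed.\<close>

lemma sec_syms: "q \<in> syms \<Longrightarrow> sec P q x \<in> syms"
proof (rule letter_cases[of x])
  fix j c :: nat assume q: "q \<in> syms" and x: "x = letter j c" "c < 4"
  have "local_sec a q c \<in> syms" if "bounded_instr N a" for a
    using q that by (cases a; cases q) (auto simp: syms_def)
  then show "sec P q x \<in> syms" using x bounded by (auto simp: syms_def)
qed

lemma out_less: "out P q x < 4 * length P \<longleftrightarrow> x < 4 * length P"
proof -
  have "y < 4 * length P \<longleftrightarrow> y div 4 < length P" for y by auto
  then show ?thesis by (metis out_div)
qed

lemma run_mealy: "run mealy (to_nat q) u = act P q u"
  by (induction u arbitrary: q) (auto simp: mealy_def)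

lemma act_X: "act P q u \<in> X \<longleftrightarrow> u \<in> X"
  by (induction u arbitrary: q) (auto simp: out_less)

lemma state_map_mealy: "state_map mealy (to_nat q) = restrict (act P q) X"
  by (simp add: state_map_def restrict_def run_mealy fun_eq_iff) (simp add: mealy_def)

lemma mealy_automaton_mealy: "mealy_automaton mealy"
  unfolding mealy_automaton_def by (auto simp: mealy_def sec_syms out_less) (simp add: syms_def)

lemma invertible_mealy_mealy: "invertible_mealy mealy"
proof -
  have "bij_betw (act P q) X X" for q
    unfolding bij_betw_def
  proof
    show "inj_on (act P q) X" using bij_is_inj[OF bij_act] by (rule inj_on_subset) simp
    have "act P q -` X = X" by (auto simp only: vimage_def act_X mem_Collect_eq)
    then show "act P q ` X = X" using surj_image_vimage_eq[OF bij_is_surj[OF bij_act], of P q X] by simp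
  qed
  then have "bij_betw (state_map mealy (to_nat q)) X X" for q :: sym
    by (simp add: state_map_mealy)
  then show ?thesis by (auto simp: invertible_mealy_def mealy_def)
qed

sublocale \<Gamma>: group \<Gamma> by (rule group_mealy_group)

lemma carrier_Bij: "carrier \<Gamma> \<subseteq> Bij X"
proof -
  have "carrier \<Gamma> \<subseteq> carrier (tree_aut_group (alphabet mealy))"
    unfolding mealy_group_def by (rule group.carrier_subgroup_generated_subset[OF group_tree_aut_group])
  then show ?thesis by (auto simp: tree_aut_group_def tree_aut_def mealy_def)
qed

lemma mult_eq: "f \<in> carrier \<Gamma> \<Longrightarrow> g \<in> carrier \<Gamma> \<Longrightarrow> f \<otimes>\<^bsub>\<Gamma>\<^esub> g = compose X f g"
proof -
  assume "f \<in> carrier \<Gamma>" "g \<in> carrier \<Gamma>"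
  then have "f \<in> Bij X" "g \<in> Bij X" using carrier_Bij by auto
  then show ?thesis
    by (simp add: mealy_group_def tree_aut_group_def BijGroup_def subgroup_generated_def) (simp add: mealy_def)
qed

lemma one_eq: "\<one>\<^bsub>\<Gamma>\<^esub> = restrict id X"
  by (simp add: mealy_group_def tree_aut_group_def BijGroup_def subgroup_generated_def restrict_def
      fun_eq_iff) (simp add: mealy_def)

text \<open>On these total maps restriction to \<open>X\<close> turns composition, powers and
  inverses into the operations of the group, so the computations above need not carry domains
  along.\<close>

definition represents :: "(nat list \<Rightarrow> nat list) \<Rightarrow> bool" where
  "represents f \<longleftrightarrow> bij f \<and> (\<forall>u. f u \<in> X \<longleftrightarrow> u \<in> X) \<and> restrict f X \<in> carrier \<Gamma>"

lemma represents_act: "q \<in> syms \<Longrightarrow> represents (act P q)"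
proof -
  assume "q \<in> syms"
  then have "state_map mealy (to_nat q) \<in> carrier \<Gamma>"
    using symmetric_generating_set_mealy_group[OF mealy_automaton_mealy invertible_mealy_mealy]
    by (auto simp: symmetric_generating_set_def mealy_def)
  then show ?thesis by (simp add: represents_def bij_act act_X state_map_mealy)
qed

lemma restrict_comp:
  assumes "represents f" "represents g"
  shows "restrict (f \<circ> g) X = restrict f X \<otimes>\<^bsub>\<Gamma>\<^esub> restrict g X"
  using assms by (auto simp: represents_def mult_eq compose_def fun_eq_iff)

lemma represents_comp: "represents f \<Longrightarrow> represents g \<Longrightarrow> represents (f \<circ> g)"
  using restrict_comp[of f g] by (auto simp: represents_def bij_comp)

lemma represents_id: "represents id"
  using \<Gamma>.one_closed by (simp add: represents_def one_eq)

lemma represents_funpow: "represents f \<Longrightarrow> represents (f ^^ n)"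
  by (induction n) (auto simp del: comp_apply intro: represents_id represents_comp)

lemma restrict_funpow: "represents f \<Longrightarrow> restrict (f ^^ n) X = restrict f X [^]\<^bsub>\<Gamma>\<^esub> n"
proof (induction n)
  case (Suc n)
  then show ?case
    by (simp only: funpow_Suc_right restrict_comp represents_funpow \<Gamma>.nat_pow_Suc)
qed (simp add: one_eq)

lemma restrict_inv: "represents f \<Longrightarrow> restrict (fun_inv f) X = inv\<^bsub>\<Gamma>\<^esub> (restrict f X)"
proof -
  assume f: "represents f"
  let ?x = "inv\<^bsub>\<Gamma>\<^esub> (restrict f X)"
  have x: "?x \<in> carrier \<Gamma>" "?x \<otimes>\<^bsub>\<Gamma>\<^esub> restrict f X = \<one>\<^bsub>\<Gamma>\<^esub>"
    using f by (auto simp: represents_def)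
  show ?thesis
  proof (rule extensionalityI[of _ X])
    fix v assume v: "v \<in> X"
    have ff: "f (fun_inv f v) = v" using f by (simp add: represents_def bij_is_surj surj_f_inv_f)
    then have "fun_inv f v \<in> X" using f v unfolding represents_def by metis
    then have "?x v = fun_inv f v"
      using fun_cong[OF x(2), of "fun_inv f v"] f x(1) ff
      by (simp add: represents_def mult_eq one_eq compose_def)
    then show "restrict (fun_inv f) X v = ?x v" using v by simp
  qed (use x carrier_Bij Bij_imp_extensional in auto)
qed

lemma represents_inv: "represents f \<Longrightarrow> represents (fun_inv f)"
proof -
  assume f: "represents f"
  then have bij: "bij f" and X: "\<And>u. f u \<in> X \<longleftrightarrow> u \<in> X" and "restrict f X \<in> carrier \<Gamma>"
    by (simp_all add: represents_def)
  have "fun_inv f u \<in> X \<longleftrightarrow> u \<in> X" for u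
    using X[of "fun_inv f u"] surj_f_inv_f[OF bij_is_surj[OF bij], of u] by simp
  then show ?thesis
    using bij_imp_bij_inv[OF bij] restrict_inv[OF f] \<Gamma>.inv_closed[OF \<open>restrict f X \<in> carrier \<Gamma>\<close>]
    unfolding represents_def by simp
qed

lemma restrict_eq_one: "restrict f X = \<one>\<^bsub>\<Gamma>\<^esub> \<longleftrightarrow> (\<forall>u\<in>X. f u = u)"
  by (auto simp: one_eq fun_eq_iff restrict_def)

lemma represents_tau: "set ls \<subseteq> {..<N} \<Longrightarrow> represents (tau P m ls)"
proof (induction ls)
  case (Cons l ls)
  then have "represents (act P (T l))" by (intro represents_act) (auto simp: syms_def)
  then show ?case using Cons unfolding tau_Cons by (intro represents_comp represents_funpow) auto
qed (simp only: tau_Nil represents_id)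

section \<open>Reduction of the halting problem\<close>

abbreviation \<alpha> :: "nat list \<Rightarrow> nat list" where "\<alpha> \<equiv> restrict (act P A) X"

abbreviation \<gamma> :: "nat \<Rightarrow> nat list \<Rightarrow> nat list" where "\<gamma> n \<equiv> restrict (conf P N (input n)) X"

lemma syms_simps: "A \<in> syms" "B 0 \<in> syms" "T 0 \<in> syms"
  using N_pos by (auto simp: syms_def)

lemmas represents_intros = represents_comp represents_inv represents_tau represents_act
  represents_funpow syms_simps

lemma represents_conf: "represents (conf P N (input n))"
  unfolding conf_def input_def fst_conv by (intro represents_intros) auto

lemma \<gamma>_closed: "\<gamma> n \<in> carrier \<Gamma>" and \<alpha>_closed: "\<alpha> \<in> carrier \<Gamma>"
  using represents_conf represents_act[OF syms_simps(1)] by (auto simp: represents_def)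

lemma \<gamma>_pow: "\<gamma> n [^]\<^bsub>\<Gamma>\<^esub> k = \<one>\<^bsub>\<Gamma>\<^esub> \<longleftrightarrow> (\<forall>u\<in>X. (conf P N (input n) ^^ k) u = u)"
  unfolding restrict_funpow[OF represents_conf, symmetric] by (rule restrict_eq_one)

lemma halts_imp_two_power_order: "halts P (input n) \<Longrightarrow> \<exists>k. \<gamma> n [^]\<^bsub>\<Gamma>\<^esub> ((2::nat) ^ k) = \<one>\<^bsub>\<Gamma>\<^esub>"
  using conf_finite_order[OF bounded] unfolding \<gamma>_pow by (metis id_apply)

lemma finite_order_imp_halts: "finite_order \<Gamma> (\<gamma> n) \<Longrightarrow> halts P (input n)"
  using conf_infinite_order[OF bounded] unfolding finite_order_def \<gamma>_pow
  by (metis less_eq_Suc_le One_nat_def)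

lemma finite_order_iff_halts: "finite_order \<Gamma> (\<gamma> n) \<longleftrightarrow> halts P (input n)"
proof
  assume "halts P (input n)"
  then obtain k where "\<gamma> n [^]\<^bsub>\<Gamma>\<^esub> ((2::nat) ^ k) = \<one>\<^bsub>\<Gamma>\<^esub>" using halts_imp_two_power_order by blast
  then show "finite_order \<Gamma> (\<gamma> n)" unfolding finite_order_def by (intro exI[of _ "2 ^ k"]) simp
qed (rule finite_order_imp_halts)

text \<open>\<open>\<gamma> n\<close> is a product \<open>b a\<close> of two involutions, with
  \<open>a\<close> restricting to \<open>\<alpha>\<close>; conjugation by \<open>a\<close> gives
  \<open>a b\<close>, its inverse.\<close>

lemma \<alpha>_inverts: "inv\<^bsub>\<Gamma>\<^esub> \<alpha> \<otimes>\<^bsub>\<Gamma>\<^esub> \<gamma> n \<otimes>\<^bsub>\<Gamma>\<^esub> \<alpha> = inv\<^bsub>\<Gamma>\<^esub> (\<gamma> n)"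
proof -
  define t where "t = tau P (snd (input n)) [0..<N]"
  define b where "b = fun_inv t \<circ> act P (B 0) \<circ> t"
  have b: "represents b" unfolding b_def t_def by (intro represents_intros) auto
  have A: "represents (act P A)" by (intro represents_intros)
  have g: "conf P N (input n) = b \<circ> act P A"
    by (simp add: conf_def b_def t_def input_def)
  have "b \<circ> b = id" unfolding b_def t_def
    by (rule involution_conj[OF bij_tau]) (auto simp: fun_eq_iff intro!: act_act)
  then have "restrict b X \<otimes>\<^bsub>\<Gamma>\<^esub> restrict b X = \<one>\<^bsub>\<Gamma>\<^esub>"
    unfolding restrict_comp[OF b b, symmetric] by (simp add: one_eq)
  then have b_inv: "inv\<^bsub>\<Gamma>\<^esub> (restrict b X) = restrict b X"
    using b by (intro \<Gamma>.inv_equality) (auto simp: represents_def)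
  have "act P A \<circ> act P A = id" by (auto simp: fun_eq_iff intro!: act_act)
  then have aa: "\<alpha> \<otimes>\<^bsub>\<Gamma>\<^esub> \<alpha> = \<one>\<^bsub>\<Gamma>\<^esub>"
    unfolding restrict_comp[OF A A, symmetric] by (simp add: one_eq)
  then have a_inv: "inv\<^bsub>\<Gamma>\<^esub> \<alpha> = \<alpha>" using \<alpha>_closed by (intro \<Gamma>.inv_equality)
  have c: "restrict b X \<in> carrier \<Gamma>" using b by (simp add: represents_def)
  have "\<alpha> \<otimes>\<^bsub>\<Gamma>\<^esub> (restrict b X \<otimes>\<^bsub>\<Gamma>\<^esub> \<alpha>) \<otimes>\<^bsub>\<Gamma>\<^esub> \<alpha> = \<alpha> \<otimes>\<^bsub>\<Gamma>\<^esub> restrict b X"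
    using aa c \<alpha>_closed by (simp add: \<Gamma>.m_assoc)
  then show ?thesis
    unfolding g restrict_comp[OF b A] a_inv \<Gamma>.inv_mult_group[OF c \<alpha>_closed] b_inv .
qed

text \<open>Iterated commutators detect only exponents that are powers of two. This suffices, since
  halting already yields such an order.\<close>

lemma engel_iff_halts:
  "(\<exists>k\<ge>1. iterated_commutator \<Gamma> k (\<gamma> n) \<alpha> = \<one>\<^bsub>\<Gamma>\<^esub>) \<longleftrightarrow> halts P (input n)"
proof -
  have *: "iterated_commutator \<Gamma> k (\<gamma> n) \<alpha> = \<one>\<^bsub>\<Gamma>\<^esub> \<longleftrightarrow> \<gamma> n [^]\<^bsub>\<Gamma>\<^esub> ((2::nat) ^ k) = \<one>\<^bsub>\<Gamma>\<^esub>" for k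
    using \<Gamma>.iterated_commutator_inverted[OF \<gamma>_closed \<alpha>_closed \<alpha>_inverts, of k n]
      \<Gamma>.inv_eq_1_iff[OF \<Gamma>.nat_pow_closed[OF \<gamma>_closed]] by (metis insertE singletonD)
  show ?thesis
  proof
    assume "\<exists>k\<ge>1. iterated_commutator \<Gamma> k (\<gamma> n) \<alpha> = \<one>\<^bsub>\<Gamma>\<^esub>"
    then obtain k where "\<gamma> n [^]\<^bsub>\<Gamma>\<^esub> ((2::nat) ^ k) = \<one>\<^bsub>\<Gamma>\<^esub>" unfolding * by blast
    then have "finite_order \<Gamma> (\<gamma> n)" unfolding finite_order_def by (intro exI[of _ "2 ^ k"]) simp
    then show "halts P (input n)" by (rule finite_order_imp_halts)
  next
    assume "halts P (input n)"
    then obtain k where "\<gamma> n [^]\<^bsub>\<Gamma>\<^esub> ((2::nat) ^ k) = \<one>\<^bsub>\<Gamma>\<^esub>" using halts_imp_two_power_order by blast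
    \<comment> \<open>One more doubling makes the number of iterations positive.\<close>
    then have "\<gamma> n [^]\<^bsub>\<Gamma>\<^esub> ((2::nat) ^ Suc k) = \<one>\<^bsub>\<Gamma>\<^esub>"
      using \<gamma>_closed by (simp add: mult_2 \<Gamma>.nat_pow_mult[symmetric])
    then show "\<exists>k\<ge>1. iterated_commutator \<Gamma> k (\<gamma> n) \<alpha> = \<one>\<^bsub>\<Gamma>\<^esub>"
      unfolding * by (intro exI[of _ "Suc k"]) auto
  qed
qed

text \<open>Only the exponent of \<open>t_0\<close> depends on \<open>n\<close>. For any generating
  set it suffices to fix one word for each of five factors and to repeat two of them
  \<open>2 ^ n\<close> times.\<close>

lemma ex_word_family:
  assumes S: "symmetric_generating_set \<Gamma> S"
  obtains w where "\<And>n. w n \<in> lists S" "\<And>n. word_value \<Gamma> (w n) = \<gamma> n"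
    "\<And>e. computable 1 (\<lambda>xs. word_code e (w (xs ! 0)))"
proof -
  \<comment> \<open>All registers except \<open>0\<close> start empty, so their generators occur in
    \<open>R\<close> with exponent \<open>1\<close>, whatever the input.\<close>
  define R where "R = tau P (\<lambda>_. 0) [1..<N]"
  have tau: "tau P (snd (input n)) [0..<N] = (act P (T 0) ^^ (2 ^ n)) \<circ> R" for n
  proof -
    have "[0..<N] = 0 # [1..<N]" using N_pos by (simp add: upt_conv_Cons)
    moreover have "tau P (snd (input n)) [1..<N] = R"
      unfolding R_def by (rule tau_cong) (auto simp: input_def)
    ultimately show ?thesis by (simp add: input_def)
  qed
  have R: "represents R" unfolding R_def by (intro represents_intros) auto
  have s: "represents (act P (T 0))" by (intro represents_intros)
  define r1 where "r1 = fun_inv R"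
  define s' where "s' = fun_inv (act P (T 0))"
  define r2 where "r2 = R \<circ> act P A"
  have reps: "represents r1" "represents s'" "represents (act P (B 0))" "represents (act P (T 0))" "represents r2"
    unfolding r1_def s'_def r2_def by (intro represents_intros R s)+
  have conf: "conf P N (input n) =
      r1 \<circ> ((s' ^^ (2 ^ n)) \<circ> (act P (B 0) \<circ> ((act P (T 0) ^^ (2 ^ n)) \<circ> r2)))" for n
    unfolding conf_def tau r1_def s'_def r2_def
    using bij_tau R s
    by (simp add: o_inv_distrib represents_def bij_fn inv_fn comp_assoc input_def)
  have "\<exists>w\<in>lists S. word_value \<Gamma> w = restrict f X" if "represents f" for f
    using \<Gamma>.ex_word[OF S] that by (simp add: represents_def)
  then obtain v where v: "v f \<in> lists S" "word_value \<Gamma> (v f) = restrict f X" if "represents f" for f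
    by metis
  have "S \<subseteq> carrier \<Gamma>" using S by (simp add: symmetric_generating_set_def)
  then have vc: "v f \<in> lists (carrier \<Gamma>)" if "represents f" for f using v(1)[OF that] by auto
  have pc: "concat (replicate k (v f)) \<in> lists U" if "v f \<in> lists U" for U k f
    using that by auto
  define w where "w n = v r1 @ concat (replicate (2 ^ n) (v s')) @ v (act P (B 0)) @
    concat (replicate (2 ^ n) (v (act P (T 0)))) @ v r2" for n :: nat
  show thesis
  proof
    show "w n \<in> lists S" for n
      unfolding w_def by (simp only: append_in_lists_conv pc v(1) reps simp_thms)
    show "computable 1 (\<lambda>xs. word_code e (w (xs ! 0)))" for e
      unfolding w_def by (rule computable_word_code)
    show "word_value \<Gamma> (w n) = \<gamma> n" for n
      unfolding w_def conf
      by (simp only: \<Gamma>.word_value_append \<Gamma>.word_value_concat_replicate vc pc reps v(2) restrict_comp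
        restrict_funpow represents_comp represents_funpow append_in_lists_conv simp_thms)
  qed
qed

text \<open>For the order problem \<open>n\<close> is sent to the word for
  \<open>\<gamma> n\<close>, for the Engel problem to its pair with a fixed word for
  \<open>\<alpha>\<close>. Injectivity of the coding pulls membership back from codes to
  words.\<close>

lemma recursive_halting:
  assumes "symmetric_generating_set \<Gamma> S"
    and "decidable_language S (order_problem \<Gamma> S) \<or> decidable_word_relation S (engel_problem \<Gamma> S)"
  shows "recursive_set {n. halts P (input n)}"
proof -
  obtain w where w: "\<And>n. w n \<in> lists S" "\<And>n. word_value \<Gamma> (w n) = \<gamma> n"
    "\<And>e. computable 1 (\<lambda>xs. word_code e (w (xs ! 0)))"
    using ex_word_family[OF assms(1)] by blast
  obtain a where a: "a \<in> lists S" "word_value \<Gamma> a = \<alpha>"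
    using \<Gamma>.ex_word[OF assms(1) \<alpha>_closed] by blast
  from assms(2) show ?thesis
  proof
    assume "decidable_language S (order_problem \<Gamma> S)"
    then obtain e where e: "inj_on e S" "recursive_set (word_code e ` order_problem \<Gamma> S)"
      unfolding decidable_language_def by blast
    have "word_code e (w n) \<in> word_code e ` order_problem \<Gamma> S \<longleftrightarrow> halts P (input n)" for n
    proof -
      have "word_code e (w n) \<in> word_code e ` order_problem \<Gamma> S \<longleftrightarrow> w n \<in> order_problem \<Gamma> S"
        using inj_on_image_mem_iff[OF inj_on_word_code[OF e(1)], of "w n" "order_problem \<Gamma> S"] w(1)
        by (auto simp: order_problem_def)
      then show ?thesis using w(1,2) by (simp add: order_problem_def finite_order_iff_halts)
    qed
    then show ?thesis using recursive_set_vimage[OF e(2) w(3)[of e]] by simp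
  next
    assume "decidable_word_relation S (engel_problem \<Gamma> S)"
    then obtain e where e: "inj_on e S"
      "recursive_set ((\<lambda>(v, w). prod_encode (word_code e v, word_code e w)) ` engel_problem \<Gamma> S)"
      unfolding decidable_word_relation_def by blast
    let ?c = "\<lambda>(v, w). prod_encode (word_code e v, word_code e w)"
    have inj: "inj_on ?c (lists S \<times> lists S)"
      using inj_on_word_code[OF e(1)] by (auto simp: inj_on_def)
    have "?c (w n, a) \<in> ?c ` engel_problem \<Gamma> S \<longleftrightarrow> halts P (input n)" for n
    proof -
      have "engel_problem \<Gamma> S \<subseteq> lists S \<times> lists S" by (auto simp: engel_problem_def)
      then have "?c (w n, a) \<in> ?c ` engel_problem \<Gamma> S \<longleftrightarrow> (w n, a) \<in> engel_problem \<Gamma> S"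
        using inj_on_image_mem_iff[OF inj, of "(w n, a)"] w(1) a(1) by blast
      then show ?thesis using w(1,2) a engel_iff_halts by (simp add: engel_problem_def)
    qed
    moreover have "computable 1 (\<lambda>xs. prod_encode (word_code e (w (xs ! 0)), word_code e a))"
      by (intro computable_prod_encode w(3) computable_const)
    ultimately show ?thesis
      using recursive_set_vimage[OF e(2), of "\<lambda>n. prod_encode (word_code e (w n), word_code e a)"]
      by simp
  qed
qed

lemma automaton_group_mealy: "automaton_group \<Gamma>"
  using mealy_automaton_mealy invertible_mealy_mealy unfolding automaton_group_def by blast

end

theorem theorem6p1:
  shows "\<exists>G :: (nat list \<Rightarrow> nat list) monoid. automaton_group G \<and>
    (\<forall>S. symmetric_generating_set G S \<longrightarrow>
      \<not> decidable_language S (order_problem G S) \<and>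
      \<not> decidable_word_relation S (engel_problem G S))"
proof -
  obtain P where P: "\<not> recursive_set {n. halts P (input n)}"
    using minsky_halting_undecidable by blast
  obtain N where N: "N \<ge> length P" "\<forall>a\<in>set P. bounded_instr N a"
    using ex_bounded_instr by blast
  \<comment> \<open>The successor guarantees a positive bound, so that \<open>T 0\<close> and
    \<open>B 0\<close> are states.\<close>
  interpret machine_automaton P "Suc N"
    using N by unfold_locales (auto intro: bounded_instr_mono)
  show ?thesis using automaton_group_mealy recursive_halting P by blast
qed

end
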